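(* Let $d\in\mathbb N$ and let $\mu_0$ be a probability measure on $\mathbb R^d$ with Lebesgue density $\pi_0:\mathbb R^d\to[0,\infty)$; set $S_0=\{x\in\mathbb R^d:\pi_0(x)>0\}$. For each $n\in\mathbb N$ let $\Phi_n:S_0\to\mathbb R$ be such that $Z_n=\int_{S_0}\exp(-n\Phi_n(x))\,\mu_0(dx)\in(0,\infty)$, let $\mu_n(dx)=Z_n^{-1}\exp(-n\Phi_n(x))\,\mu_0(dx)$, and let $I_n(x)=\Phi_n(x)-\frac1n\log\pi_0(x)$ for $x\in S_0$. Assume: (A1) For every $n$, $\Phi_n,\pi_0\in C^2(S_0,\mathbb R)$, and $I_n$ has a unique minimizer $x_n\in S_0$ with $I_n(x_n)=0$, $\nabla I_n(x_n)=0$ and $\nabla^2 I_n(x_n)$ positive definite. (A2) $\Phi_n,\pi_0\in C^3(S_0,\mathbb R)$ for all $n$, and (i) the limits $x_\star=\lim_{n\to\infty}x_n\in\mathbb R^d$ and $H_\star=\lim_{n\to\infty}\nabla^2\Phi_n(x_n)\in\mathbb R^{d\times d}$ exist, $H_\star$ is positive definite and $x_\star$ lies in the interior of $S_0$; (ii) for each $r>0$ there exist $n_r\in\mathbb N$, $\delta_r>0$ and $K_r<\infty$ such that for all $n\ge n_r$: $I_n(x)\ge\delta_r$ for all $x\in S_0$ with $\|x-x_n\|>r$, and $\max_{x\in S_0,\|x\|\le r}\|\nabla^3\log\pi_0(x)\|\le K_r$, $\max_{x\in S_0,\|x\|\le r}\|\nabla^3\Phi_n(x)\|\le K_r$; (iii)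 there exist $n_0\in\mathbb N$, $\epsilon\in(0,1)$ and $q:S_0\to[0,\infty)$ with $\exp(-nI_n(x))\le q(x)$ for all $x\in S_0$, $n\ge n_0$, and $\int_{S_0}q(x)^{1-\epsilon}\,dx<\infty$. Let $\mathcal L_{\mu_n}=\mathcal N(x_n,n^{-1}C_n)$ with $C_n^{-1}=\nabla^2I_n(x_n)$. Then $d_H(\mu_n,\mathcal L_{\mu_n})\in\mathcal O(n^{-1/2})$ as $n\to\infty$.
   Context: $\mathcal L_{\mu_n}$ is called the Laplace approximation of $\mu_n$. The Hellinger distance of probability measures $\mu,\nu$ on $\mathbb R^d$ is $d_H(\mu,\nu)^2=\int\big(\sqrt{d\mu/d\rho}-\sqrt{d\nu/d\rho}\big)^2\,d\rho$ for any probability measure $\rho$ dominating both. $\|\nabla^3 g(x)\|$ denotes an operator norm of the third derivative tensor. *)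

theory Defs
  imports "HOL-Probability.Probability" "HOL-Library.Landau_Symbols"
begin

text \<open>Iterated (Frechet) derivatives within a set S, represented as multilinear forms:
  D j x hs is the j-th derivative of f at x applied to the directions hs (length hs = j).
  has_derivs_on k S f D says f is C^k on S with derivatives D.\<close>
definition has_derivs_on ::
  "nat \<Rightarrow> ('a::real_normed_vector) set \<Rightarrow> ('a \<Rightarrow> real) \<Rightarrow> (nat \<Rightarrow> 'a \<Rightarrow> 'a list \<Rightarrow> real) \<Rightarrow> bool"
where
  "has_derivs_on k S f D \<longleftrightarrow>
     (\<forall>x\<in>S. D 0 x [] = f x) \<and>
     (\<forall>j<k. \<forall>x\<in>S. \<forall>hs. length hs = j \<longrightarrow>
        ((\<lambda>y. D j y hs) has_derivative (\<lambda>h. D (Suc j) x (h # hs))) (at x within S)) \<and>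
     (\<forall>hs. length hs = k \<longrightarrow> continuous_on S (\<lambda>y. D k y hs))"

definition hess_mat :: "(real^'n \<Rightarrow> (real^'n) list \<Rightarrow> real) \<Rightarrow> real^'n \<Rightarrow> real^'n^'n" where
  "hess_mat D2 x = (\<chi> i j. D2 x [axis i 1, axis j 1])"

definition posdef :: "real^'n^'n \<Rightarrow> bool" where
  "posdef M \<longleftrightarrow> (\<forall>v. v \<noteq> 0 \<longrightarrow> v \<bullet> (M *v v) > 0)"

definition opnorm3 :: "('a::real_normed_vector list \<Rightarrow> real) \<Rightarrow> real" where
  "opnorm3 T = Sup {\<bar>T [h1, h2, h3]\<bar> | h1 h2 h3. norm h1 \<le> 1 \<and> norm h2 \<le> 1 \<and> norm h3 \<le> 1}"

definition gaussian :: "real^'n \<Rightarrow> real^'n^'n \<Rightarrow> (real^'n) measure" where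
  "gaussian m Cov = density lborel (\<lambda>x. ennreal
     ((2 * pi) powr (- real CARD('n) / 2) / sqrt (det Cov) *
      exp (- (1/2) * ((x - m) \<bullet> (matrix_inv Cov *v (x - m))))))"

definition hellinger_dist :: "'a measure \<Rightarrow> 'a measure \<Rightarrow> real" where
  "hellinger_dist \<mu> \<nu> =
     (let \<rho> = (SOME \<rho>. prob_space \<rho> \<and> sets \<rho> = sets \<mu> \<and> sets \<nu> = sets \<mu> \<and>
                        absolutely_continuous \<rho> \<mu> \<and> absolutely_continuous \<rho> \<nu>)
      in sqrt (enn2real (\<integral>\<^sup>+x. ennreal ((sqrt (enn2real (RN_deriv \<rho> \<mu> x))
                                       - sqrt (enn2real (RN_deriv \<rho> \<nu> x)))^2) \<partial>\<rho>)))"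

end

theory Submission
  imports Defs "HOL-Real_Asymp.Real_Asymp"
begin

text \<open>
  Write \<open>g = exp (- n I\<^sub>n)\<close> on \<open>S\<^sub>0\<close> (and \<open>0\<close> elsewhere) and \<open>h = exp (- n/2 v\<^sup>T H\<^sub>n v)\<close> with
  \<open>v = x - x\<^sub>n\<close>, \<open>H\<^sub>n = \<nabla>\<^sup>2 I\<^sub>n(x\<^sub>n)\<close>: the unnormalised densities of \<open>\<mu>\<^sub>n\<close> and of its Laplace
  approximation. If \<open>W = \<integral> h\<close>, then \<open>d\<^sub>H\<^sup>2 \<le> (2 / W) \<integral> (\<surd>g - \<surd>h)\<^sup>2\<close>, and \<open>W\<close> is of order \<open>n powr (- d/2)\<close>.
  Near \<open>x\<^sub>n\<close> the third-order Taylor remainder gives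
  \<open>(\<surd>g - \<surd>h)\<^sup>2 \<le> C n\<^sup>2 |v|^6 exp (- n b |v|\<^sup>2)\<close>, whose integral is of order \<open>n powr (- 1 - d/2)\<close>.
  Away from \<open>x\<^sub>n\<close> the same bound covers \<open>h\<close>, while
  \<open>g = exp (- \<epsilon> n I\<^sub>n) exp (- (1 - \<epsilon>) n I\<^sub>n) \<le> exp (- \<epsilon> \<delta> n) q powr (1 - \<epsilon>)\<close> is exponentially small in \<open>L\<^sup>1\<close>.
\<close>

section \<open>Linear substitutions and Gaussian integrals\<close>

text \<open>The prefactor \<open>2 / W\<close> involves the Gaussian mass alone: the mass of
  \<open>g\<close> is eliminated by minimising over it, so no asymptotic expansion of
  \<open>Z\<^sub>n\<close> is ever made. The powers depending on the dimension cancel between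
  \<open>1 / W\<close> and the rescaled sixth moment, which leaves order \<open>1 / n\<close> for
  the squared distance. Three obstacles shape the rest. The set \<open>S\<^sub>0\<close> need not be
  open, and derivatives within it need not be unique, so the calculus takes place in a ball around
  the limit of the \<open>x\<^sub>n\<close>; there the separately given derivative families are
  matched by uniqueness. These families are bare functions of lists of directions, so multilinearity
  and symmetry are derived from differentiability before Taylor's formula can be expressed through a
  Hessian matrix and \<open>opnorm3\<close>. Finally, the distance is defined through an arbitrarily
  chosen dominating measure and has to be reduced to Lebesgue densities.\<close>

text \<open>The change of variables theorems of HOL-Analysis need a well-ordered index type.\<close>

lemma nn_integral_lborel_shear:
  fixes f :: "'a::euclidean_space \<Rightarrow> ennreal"
  assumes [measurable]: "f \<in> borel_measurable borel"
    and u: "u \<in> Basis" and v: "v \<in> Basis" and "u \<noteq> v"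
  shows "(\<integral>\<^sup>+x. f (x + (c * (x \<bullet> v)) *\<^sub>R u) \<partial>lborel) = (\<integral>\<^sup>+x. f x \<partial>lborel)"
proof -
  interpret product_sigma_finite "\<lambda>_::'a. lborel :: real measure"
    by standard
  define B where "B = Basis - {u}"
  have B: "finite B" "u \<notin> B" "Basis = insert u B" "v \<in> B"
    using u v \<open>u \<noteq> v\<close> by (auto simp: B_def)
  \<comment> \<open>Fubini with the \<open>u\<close> coordinate \<open>y\<close> innermost: for
    fixed remaining coordinates, among them \<open>x v\<close>, the shear only translates
    \<open>y\<close> by \<open>c * x v\<close>, which preserves the one-dimensional
    integral.\<close>
  have split: "(\<integral>\<^sup>+x. g x \<partial>lborel) =
      (\<integral>\<^sup>+x. (\<integral>\<^sup>+y. g (y *\<^sub>R u + (\<Sum>b\<in>B. x b *\<^sub>R b)) \<partial>lborel) \<partial>(Pi\<^sub>M B (\<lambda>_. lborel)))"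
    if [measurable]: "g \<in> borel_measurable borel" for g :: "'a \<Rightarrow> ennreal"
  proof -
    have "(\<integral>\<^sup>+x. g x \<partial>lborel) = (\<integral>\<^sup>+x. g (\<Sum>b\<in>Basis. x b *\<^sub>R b) \<partial>(\<Pi>\<^sub>M b\<in>Basis. lborel))"
      by (subst lborel_eq, subst nn_integral_distr) auto
    also have "\<dots> = (\<integral>\<^sup>+x. (\<integral>\<^sup>+y. g (\<Sum>b\<in>insert u B. (x(u:=y)) b *\<^sub>R b) \<partial>lborel) \<partial>(Pi\<^sub>M B (\<lambda>_. lborel)))"
      unfolding B(3) using B(1,2) by (subst product_nn_integral_insert) auto
    also have "\<dots> = (\<integral>\<^sup>+x. (\<integral>\<^sup>+y. g (y *\<^sub>R u + (\<Sum>b\<in>B. x b *\<^sub>R b)) \<partial>lborel) \<partial>(Pi\<^sub>M B (\<lambda>_. lborel)))"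
    proof (intro nn_integral_cong arg_cong[where f=g])
      fix x y
      have "(\<Sum>b\<in>B. (x(u:=y)) b *\<^sub>R b) = (\<Sum>b\<in>B. x b *\<^sub>R b)"
        using B(2) by (intro sum.cong) auto
      then show "(\<Sum>b\<in>insert u B. (x(u:=y)) b *\<^sub>R b) = y *\<^sub>R u + (\<Sum>b\<in>B. x b *\<^sub>R b)"
        using B(1,2) by simp
    qed
    finally show ?thesis .
  qed
  have comp: "(y *\<^sub>R u + (\<Sum>b\<in>B. x b *\<^sub>R b)) \<bullet> v = x v" for x :: "'a \<Rightarrow> real" and y
  proof -
    have "(\<Sum>b\<in>B. x b *\<^sub>R b) \<bullet> v = (\<Sum>b\<in>B. if b = v then x b else 0)"
      unfolding inner_sum_left using v
      by (intro sum.cong refl) (simp add: inner_Basis B_def)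
    then show ?thesis
      using B(1,4) u v \<open>u \<noteq> v\<close> by (simp add: inner_add_left inner_Basis)
  qed
  have "(\<integral>\<^sup>+x. f (x + (c * (x \<bullet> v)) *\<^sub>R u) \<partial>lborel) =
      (\<integral>\<^sup>+x. (\<integral>\<^sup>+y. f ((c * x v + 1 * y) *\<^sub>R u + (\<Sum>b\<in>B. x b *\<^sub>R b)) \<partial>lborel) \<partial>(Pi\<^sub>M B (\<lambda>_. lborel)))"
    by (subst split) (simp_all only: comp, simp_all add: scaleR_add_left add_ac)
  also have "\<dots> = (\<integral>\<^sup>+x. (\<integral>\<^sup>+y. f (y *\<^sub>R u + (\<Sum>b\<in>B. x b *\<^sub>R b)) \<partial>lborel) \<partial>(Pi\<^sub>M B (\<lambda>_. lborel)))"
  proof (rule nn_integral_cong)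
    fix x
    show "(\<integral>\<^sup>+y. f ((c * x v + 1 * y) *\<^sub>R u + (\<Sum>b\<in>B. x b *\<^sub>R b)) \<partial>lborel) =
      (\<integral>\<^sup>+y. f (y *\<^sub>R u + (\<Sum>b\<in>B. x b *\<^sub>R b)) \<partial>lborel)"
      by (subst (2) nn_integral_real_affine[where c=1 and t="c * x v"]) auto
  qed
  also have "\<dots> = (\<integral>\<^sup>+x. f x \<partial>lborel)"
    by (rule split[symmetric]) simp
  finally show ?thesis .
qed

text \<open>Lebesgue measure is determined by its values on boxes, and the preimage of a box under a
  coordinate permutation is a box with the same side lengths in another order.\<close>

lemma nn_integral_lborel_permute:
  fixes f :: "real^'n \<Rightarrow> ennreal"
  assumes [measurable]: "f \<in> borel_measurable borel" and p: "bij (p :: 'n \<Rightarrow> 'n)"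
  shows "(\<integral>\<^sup>+x. f (\<chi> i. x $ p i) \<partial>lborel) = (\<integral>\<^sup>+x. f x \<partial>lborel)"
proof -
  have [measurable]: "(\<lambda>x::real^'n. \<chi> i. x $ p i) \<in> borel \<rightarrow>\<^sub>M borel"
    by (intro borel_measurable_continuous_onI continuous_intros)
  have inv: "\<And>i. p (inv p i) = i" "\<And>i. inv p (p i) = i"
    using p by (simp_all add: bij_is_surj surj_f_inv_f bij_is_inj inv_f_f)
  have "lborel = distr lborel borel (\<lambda>x::real^'n. \<chi> i. x $ p i)"
  proof (rule lborel_eqI)
    fix l u :: "real^'n"
    assume le: "\<And>b. b \<in> Basis \<Longrightarrow> l \<bullet> b \<le> u \<bullet> b"
    then have le': "l $ i \<le> u $ i" for i
      using le[of "axis i 1"] by (simp add: inner_axis)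
    have pre: "(\<lambda>x::real^'n. \<chi> i. x $ p i) -` box l u =
        box (\<chi> i. l $ inv p i) (\<chi> i. u $ inv p i)"
      by (auto simp: mem_box_cart) (metis inv)+
    have box: "emeasure lborel (box a b) = ennreal (\<Prod>i\<in>UNIV. b $ i - a $ i)"
      if "\<And>i. a $ i \<le> b $ i" for a b :: "real^'n"
    proof -
      have "(\<Prod>i\<in>UNIV. b $ i - a $ i) = (\<Prod>v\<in>Basis. (b - a) \<bullet> v)"
        unfolding Basis_vec_def
        by (simp add: UNION_singleton_eq_range prod.reindex inj_on_def axis_eq_axis inner_axis)
      moreover have "\<And>v. v \<in> Basis \<Longrightarrow> a \<bullet> v \<le> b \<bullet> v"
        using that by (auto simp: Basis_vec_def inner_axis)
      ultimately show ?thesis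
        by (simp add: emeasure_lborel_box)
    qed
    have "emeasure (distr lborel borel (\<lambda>x::real^'n. \<chi> i. x $ p i)) (box l u) =
        ennreal (\<Prod>i\<in>UNIV. u $ inv p i - l $ inv p i)"
      by (subst emeasure_distr) (auto simp: pre box le')
    also have "(\<Prod>i\<in>UNIV. u $ inv p i - l $ inv p i) = (\<Prod>i\<in>UNIV. u $ i - l $ i)"
      using bij_imp_bij_inv[OF p] prod.reindex_bij_betw[of "inv p" UNIV UNIV "\<lambda>i. u $ i - l $ i"] by simp
    also have "\<dots> = (\<Prod>v\<in>Basis. (u - l) \<bullet> v)"
      unfolding Basis_vec_def
      by (simp add: UNION_singleton_eq_range prod.reindex inj_on_def axis_eq_axis inner_axis)
    finally show "emeasure (distr lborel borel (\<lambda>x::real^'n. \<chi> i. x $ p i)) (box l u) =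
        ennreal (\<Prod>v\<in>Basis. (u - l) \<bullet> v)" .
  qed simp
  then have "(\<integral>\<^sup>+x. f x \<partial>lborel) = (\<integral>\<^sup>+x. f x \<partial>distr lborel borel (\<lambda>x::real^'n. \<chi> i. x $ p i))"
    by (rule arg_cong)
  then show ?thesis
    by (subst (asm) nn_integral_distr) auto
qed

lemma nn_integral_lborel_stretch:
  fixes f :: "real^'n \<Rightarrow> ennreal"
  assumes [measurable]: "f \<in> borel_measurable borel" and c: "\<And>i. c i \<noteq> (0::real)"
  shows "(\<integral>\<^sup>+x. f x \<partial>lborel) = ennreal \<bar>\<Prod>i\<in>UNIV. c i\<bar> * (\<integral>\<^sup>+x. f (\<chi> i. c i * x $ i) \<partial>lborel)"
proof -
  \<comment> \<open>The affine change of variables takes its factors indexed by basis vectors, so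
    \<open>c\<close> is transported from the index type along \<open>axis_index\<close>.\<close>
  define c' where "c' v = c (axis_index v)" for v :: "real^'n"
  have c': "c' (axis i 1) = c i" for i
    by (simp add: c'_def axis_index_axis)
  have T: "0 + (\<Sum>j\<in>Basis. (c' j * (x \<bullet> j)) *\<^sub>R j) = (\<chi> i. c i * x $ i)" for x :: "real^'n"
    unfolding Basis_vec_def
    by (simp add: UNION_singleton_eq_range sum.reindex inj_on_def axis_eq_axis inner_axis c')
       (simp add: axis_def vec_eq_iff if_distrib cong: if_cong)
  have P: "(\<Prod>j\<in>Basis. \<bar>c' j\<bar>) = \<bar>\<Prod>i\<in>UNIV. c i\<bar>"
    unfolding Basis_vec_def
    by (simp add: UNION_singleton_eq_range prod.reindex inj_on_def axis_eq_axis c' abs_prod)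
  have [measurable]: "(\<lambda>x::real^'n. \<chi> i. c i * x $ i) \<in> borel \<rightarrow>\<^sub>M borel"
    by (intro borel_measurable_continuous_onI continuous_intros)
  have "lborel = density (distr lborel borel (\<lambda>x::real^'n. \<chi> i. c i * x $ i)) (\<lambda>_. ennreal \<bar>\<Prod>i\<in>UNIV. c i\<bar>)"
    using lborel_affine_euclidean[of c' "0::real^'n"] c unfolding T P by (simp add: c'_def)
  then have "(\<integral>\<^sup>+x. f x \<partial>lborel) = (\<integral>\<^sup>+x. f x \<partial>density (distr lborel borel (\<lambda>x::real^'n. \<chi> i. c i * x $ i)) (\<lambda>_. ennreal \<bar>\<Prod>i\<in>UNIV. c i\<bar>))"
    by (rule arg_cong)
  then show ?thesis
    by (simp add: nn_integral_density nn_integral_distr nn_integral_cmult)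
qed

text \<open>Induction over products of elementary matrices: shears, transpositions and diagonal
  matrices are the three preceding lemmas, and a zero row makes the determinant vanish.\<close>

lemma nn_integral_lborel_linear:
  fixes f :: "real^'n \<Rightarrow> ennreal" and A :: "real^'n^'n"
  assumes "f \<in> borel_measurable borel" and "det A \<noteq> 0"
  shows "(\<integral>\<^sup>+x. f x \<partial>lborel) = ennreal \<bar>det A\<bar> * (\<integral>\<^sup>+x. f (A *v x) \<partial>lborel)"
proof -
  have meas: "(\<lambda>x. g (A *v x)) \<in> borel_measurable borel"
    if "g \<in> borel_measurable borel" for A :: "real^'n^'n" and g :: "real^'n \<Rightarrow> ennreal"
    using that by (intro measurable_compose[OF _ that])
      (intro borel_measurable_continuous_onI linear_continuous_on
        matrix_vector_mul_bounded_linear)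
  \<comment> \<open>\<open>P\<close> ranges over all \<open>f\<close>, because the product step
    applies the hypothesis on \<open>B\<close> to the function \<open>f (A *v x)\<close> instead of
    \<open>f\<close>. A nonzero determinant of a product passes to both factors.\<close>
  define P where "P A \<longleftrightarrow> (det A \<noteq> 0 \<longrightarrow> (\<forall>f\<in>borel_measurable borel.
      (\<integral>\<^sup>+x. f x \<partial>lborel) = ennreal \<bar>det A\<bar> * (\<integral>\<^sup>+x. f (A *v x) \<partial>lborel)))" for A :: "real^'n^'n"
  have "P A"
  proof (rule induct_matrix_elementary)
    fix A B :: "real^'n^'n"
    assume A: "P A" and B: "P B"
    show "P (A ** B)"
      unfolding P_def
    proof (intro impI ballI)
      fix f :: "real^'n \<Rightarrow> ennreal"
      assume "det (A ** B) \<noteq> 0" and f: "f \<in> borel_measurable borel"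
      then have nz: "det A \<noteq> 0" "det B \<noteq> 0" by (auto simp: det_mul)
      have "(\<integral>\<^sup>+x. f x \<partial>lborel) = ennreal \<bar>det A\<bar> * (\<integral>\<^sup>+x. f (A *v x) \<partial>lborel)"
        using A nz f by (simp add: P_def)
      also have "(\<integral>\<^sup>+x. f (A *v x) \<partial>lborel) = ennreal \<bar>det B\<bar> * (\<integral>\<^sup>+x. f (A *v (B *v x)) \<partial>lborel)"
        using B nz(2) meas[OF f, of A] unfolding P_def by (elim impE) auto
      finally show "(\<integral>\<^sup>+x. f x \<partial>lborel) = ennreal \<bar>det (A ** B)\<bar> * (\<integral>\<^sup>+x. f ((A ** B) *v x) \<partial>lborel)"
        by (simp add: det_mul abs_mult ennreal_mult mult.assoc matrix_vector_mul_assoc)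
    qed
  next
    fix A :: "real^'n^'n" and i assume "row i A = 0"
    then show "P A" by (simp add: P_def det_zero_row)
  next
    fix A :: "real^'n^'n" assume diag: "\<And>i j. i \<noteq> j \<Longrightarrow> A $ i $ j = 0"
    have "A *v x = (\<chi> i. A $ i $ i * x $ i)" for x
    proof (subst vec_eq_iff, intro allI)
      fix i
      have "(\<Sum>j\<in>UNIV. A $ i $ j * x $ j) = (\<Sum>j\<in>UNIV. if j = i then A $ i $ i * x $ i else 0)"
        using diag by (intro sum.cong) auto
      then show "(A *v x) $ i = (\<chi> i. A $ i $ i * x $ i) $ i"
        by (simp add: matrix_vector_mult_def)
    qed
    then show "P A"
      using nn_integral_lborel_stretch[where c="\<lambda>i. A $ i $ i"]
      by (auto simp: P_def det_diagonal[OF diag])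
  next
    fix m n :: 'n assume "m \<noteq> n"
    let ?p = "Transposition.transpose m n"
    have p: "?p permutes UNIV" by (simp add: permutes_swap_id)
    have d: "\<bar>det (\<chi> i j. mat 1 $ i $ ?p j :: real^'n^'n)\<bar> = 1"
      by (subst det_permute_columns[OF p]) (simp add: sign_swap_id)
    have "(\<chi> i j. mat 1 $ i $ ?p j) *v x = (\<chi> i. x $ ?p i)" for x :: "real^'n"
    proof (subst vec_eq_iff, intro allI)
      fix i
      have "(\<Sum>j\<in>UNIV. (if i = ?p j then 1 else 0) * x $ j) = (\<Sum>j\<in>UNIV. if j = ?p i then x $ ?p i else 0)"
        by (intro sum.cong) auto
      then show "((\<chi> i j. mat 1 $ i $ ?p j) *v x) $ i = (\<chi> i. x $ ?p i) $ i"
        by (simp add: matrix_vector_mult_def mat_def)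
    qed
    then show "P (\<chi> i j. mat 1 $ i $ ?p j)"
      unfolding P_def d using nn_integral_lborel_permute[OF _ permutes_bij[OF p]] by simp
  next
    fix m n :: 'n and c :: real assume mn: "m \<noteq> n"
    let ?E = "\<chi> i j. if i = m \<and> j = n then c else of_bool (i = j)"
    have "?E = (\<chi> k. if k = m then row m (mat 1) + c *s row n (mat 1) else row k (mat 1))"
      using mn by (auto simp: vec_eq_iff row_def mat_def)
    then have d: "det ?E = 1"
      using det_row_operation[OF mn, of "mat 1 :: real^'n^'n" c] by simp
    have "?E *v x = x + (c * (x \<bullet> axis n 1)) *\<^sub>R axis m 1" for x
    proof (subst vec_eq_iff, intro allI)
      fix i
      have "(\<Sum>j\<in>UNIV. (if i = m \<and> j = n then c else of_bool (i = j)) * x $ j)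
          = (\<Sum>j\<in>UNIV. (if j = i then x $ i else 0) + (if j = n then (if i = m then c * x $ n else 0) else 0))"
        using mn by (intro sum.cong) auto
      then show "(?E *v x) $ i = (x + (c * (x \<bullet> axis n 1)) *\<^sub>R axis m 1) $ i"
        by (simp add: matrix_vector_mult_def sum.distrib inner_axis) (simp add: axis_def)
    qed
    then show "P ?E"
      unfolding P_def d
      using nn_integral_lborel_shear[of _ "axis m 1 :: real^'n" "axis n 1" c] mn by (simp add: axis_eq_axis)
  qed
  then show ?thesis using assms by (simp add: P_def)
qed

section \<open>Gaussian integrals and moments\<close>

lemma nn_integral_std_gaussian:
  "(\<integral>\<^sup>+x. ennreal (exp (- (x \<bullet> x) / 2)) \<partial>(lborel :: (real^'n) measure)) = ennreal ((2 * pi) powr (real CARD('n) / 2))"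
proof -
  have one: "(\<integral>\<^sup>+x. ennreal (exp (- (x\<^sup>2) / 2)) \<partial>lborel) = ennreal (sqrt (2 * pi))"
  proof -
    have "(\<integral>\<^sup>+x. ennreal (exp (- (x\<^sup>2) / 2)) \<partial>lborel) = (\<integral>\<^sup>+x. ennreal (sqrt (2 * pi)) * ennreal (std_normal_density x) \<partial>lborel)"
      by (intro nn_integral_cong) (auto simp: std_normal_density_def ennreal_mult[symmetric] simp del: real_sqrt_mult)
    also have "\<dots> = ennreal (sqrt (2 * pi)) * (\<integral>\<^sup>+x. ennreal (std_normal_density x) \<partial>lborel)"
      by (intro nn_integral_cmult) auto
    also have "(\<integral>\<^sup>+x. ennreal (std_normal_density x) \<partial>lborel) = 1"
      by (subst nn_integral_eq_integral) auto
    finally show ?thesis by simp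
  qed
  have "exp (- (x \<bullet> x) / 2) = (\<Prod>b\<in>Basis. exp (- ((x \<bullet> b)\<^sup>2) / 2))" for x :: "real^'n"
  proof -
    have "- (x \<bullet> x) / 2 = (\<Sum>b\<in>Basis. - ((x \<bullet> b)\<^sup>2) / 2)"
      by (subst euclidean_inner) (simp add: power2_eq_square sum_negf sum_divide_distrib)
    then show ?thesis by (simp add: exp_sum)
  qed
  then have "(\<integral>\<^sup>+x. ennreal (exp (- (x \<bullet> x) / 2)) \<partial>(lborel :: (real^'n) measure)) =
      (\<integral>\<^sup>+x. (\<Prod>b\<in>Basis. ennreal (exp (- ((x \<bullet> b)\<^sup>2) / 2))) \<partial>(lborel :: (real^'n) measure))"
    by (simp add: prod_ennreal)
  also have "\<dots> = (\<Prod>b\<in>(Basis::(real^'n) set). ennreal (sqrt (2 * pi)))"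
    by (subst nn_integral_lborel_prod) (simp_all add: one del: minus_divide_left prod_constant minus_divide_left[symmetric])
  also have "\<dots> = ennreal ((2 * pi) powr (real CARD('n) / 2))"
    by (simp add: ennreal_power powr_half_sqrt[symmetric] powr_realpow[symmetric] powr_powr del: real_sqrt_mult)
  finally show ?thesis .
qed

text \<open>Gram-Schmidt for the inner product \<open>v \<bullet> (M *v w)\<close>: the columns of
  \<open>B\<close> form a basis orthonormal for it. This is the substitution that turns the
  quadratic form into the Euclidean one, and it gives \<open>det M\<close> as the inverse of a
  square.\<close>

lemma posdef_congruent_identity:
  fixes M :: "real^'n^'n"
  assumes pd: "posdef M" and sym: "transpose M = M"
  obtains B :: "real^'n^'n" where "transpose B ** M ** B = mat 1"
proof -
  have "\<exists>b :: 'n \<Rightarrow> real^'n. \<forall>i\<in>J. \<forall>j\<in>J. b i \<bullet> (M *v b j) = of_bool (i = j)" if "finite J" for J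
    using that
  proof induction
    case empty
    then show ?case by simp
  next
    case (insert k J)
    then obtain b where b: "\<And>i j. i \<in> J \<Longrightarrow> j \<in> J \<Longrightarrow> b i \<bullet> (M *v b j) = of_bool (i = j)"
      by blast
    \<comment> \<open>Fewer than \<open>CARD('n)\<close> vectors cannot span, so some
      \<open>w\<close> lies outside their span; removing its components along them leaves a nonzero
      \<open>v\<close>.\<close>
    have "card (b ` J) < CARD('n)"
      using insert by (metis UNIV_I card_image_le card_seteq finite_class.finite_UNIV le_neq_implies_less le_trans not_le subset_UNIV)
    then have "dim (span (b ` J)) < DIM(real^'n)"
      using dim_le_card'[of "b ` J"] insert(1) by simp
    then have "span (b ` J) \<noteq> UNIV"
      by (metis dim_UNIV less_irrefl)
    then obtain w where w: "w \<notin> span (b ` J)" by blast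
    define v where "v = w - (\<Sum>j\<in>J. (b j \<bullet> (M *v w)) *\<^sub>R b j)"
    have "(\<Sum>j\<in>J. (b j \<bullet> (M *v w)) *\<^sub>R b j) \<in> span (b ` J)"
      by (intro span_sum span_scale span_base) auto
    then have "v \<noteq> 0" using w by (auto simp: v_def)
    then have pos: "v \<bullet> (M *v v) > 0" using pd by (simp add: posdef_def)
    have orth: "b i \<bullet> (M *v v) = 0" if "i \<in> J" for i
    proof -
      have "M *v v = M *v w - (\<Sum>j\<in>J. (b j \<bullet> (M *v w)) *\<^sub>R (M *v b j))"
        unfolding v_def
        by (simp add: matrix_vector_mult_diff_distrib linear_sum[OF matrix_vector_mul_linear] linear_scale[OF matrix_vector_mul_linear])
      then have "b i \<bullet> (M *v v) = b i \<bullet> (M *v w) - (\<Sum>j\<in>J. (b j \<bullet> (M *v w)) * of_bool (i = j))"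
        using that by (simp add: inner_diff_right inner_sum_right b)
      also have "(\<Sum>j\<in>J. (b j \<bullet> (M *v w)) * of_bool (i = j)) = (\<Sum>j\<in>J. if j = i then b i \<bullet> (M *v w) else 0)"
        by (intro sum.cong) auto
      finally show ?thesis using that insert(1) by simp
    qed
    have orth': "v \<bullet> (M *v b i) = 0" if "i \<in> J" for i
      using orth[OF that] by (metis dot_lmul_matrix inner_commute sym transpose_matrix_vector)
    define b' where "b' = b(k := (1 / sqrt (v \<bullet> (M *v v))) *\<^sub>R v)"
    have "b' i \<bullet> (M *v b' j) = of_bool (i = j)" if "i \<in> insert k J" "j \<in> insert k J" for i j
      using that insert(2) orth orth' b pos
      by (auto simp: b'_def linear_scale[OF matrix_vector_mul_linear] real_sqrt_mult_self power2_eq_square[symmetric] real_divide_square_eq)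
    then show ?case by blast
  qed
  from this[of UNIV] obtain b :: "'n \<Rightarrow> real^'n" where b: "\<And>i j. b i \<bullet> (M *v b j) = of_bool (i = j)"
    by auto
  define B where "B = (\<chi> i j. b j $ i)"
  have "(transpose B ** M ** B) $ i $ j = b i \<bullet> (M *v b j)" for i j
  proof -
    have "(transpose B ** M ** B) $ i $ j = (transpose B ** (M ** B)) $ i $ j"
      by (simp add: matrix_mul_assoc)
    also have "\<dots> = b i \<bullet> (M *v b j)"
      by (simp add: matrix_matrix_mult_def matrix_vector_mult_def B_def transpose_def inner_vec_def)
    finally show ?thesis .
  qed
  then have "transpose B ** M ** B = mat 1"
    by (simp add: vec_eq_iff b mat_def)
  then show ?thesis by (rule that)
qed

lemma posdef_det_pos:
  fixes M :: "real^'n^'n"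
  assumes "posdef M" and "transpose M = M"
  shows "det M > 0"
proof -
  obtain B :: "real^'n^'n" where "transpose B ** M ** B = mat 1"
    using posdef_congruent_identity[OF assms] .
  then have "det B * det M * det B = 1"
    by (metis det_I det_mul det_transpose)
  then have "(det B)\<^sup>2 * det M = 1" by (simp add: power2_eq_square mult_ac)
  then show ?thesis
    by (metis zero_less_mult_iff zero_less_one not_less zero_le_power2)
qed

text \<open>Under \<open>x = B *v y\<close> the form becomes \<open>y \<bullet> y\<close>, and the
  Jacobian \<open>\<bar>det B\<bar>\<close> equals \<open>1 / sqrt (det M)\<close>.\<close>

lemma nn_integral_gaussian_quadratic:
  fixes M :: "real^'n^'n"
  assumes pd: "posdef M" and sym: "transpose M = M"
  shows "(\<integral>\<^sup>+x. ennreal (exp (- (1/2) * (x \<bullet> (M *v x)))) \<partial>lborel)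
       = ennreal ((2 * pi) powr (real CARD('n) / 2) / sqrt (det M))"
proof -
  obtain B :: "real^'n^'n" where B: "transpose B ** M ** B = mat 1"
    using posdef_congruent_identity[OF assms] .
  then have "det B * det M * det B = 1"
    by (metis det_I det_mul det_transpose)
  then have dB: "(det B)\<^sup>2 * det M = 1" by (simp add: power2_eq_square mult_ac)
  then have "det B \<noteq> 0" by auto
  have "\<bar>det B\<bar> * sqrt (det M) = 1"
    using dB by (metis real_sqrt_abs real_sqrt_mult real_sqrt_one)
  then have absB: "\<bar>det B\<bar> = 1 / sqrt (det M)"
    by (metis mult_zero_right nonzero_eq_divide_eq zero_neq_one)
  have quad: "(B *v x) \<bullet> (M *v (B *v x)) = x \<bullet> x" for x
  proof -
    have "(B *v x) \<bullet> (M *v (B *v x)) = x \<bullet> (transpose B *v (M *v (B *v x)))"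
      by (metis dot_lmul_matrix inner_commute transpose_matrix_vector transpose_transpose)
    also have "transpose B *v (M *v (B *v x)) = x"
      by (metis B matrix_vector_mul_assoc matrix_vector_mul_lid)
    finally show ?thesis .
  qed
  have meas: "(\<lambda>x. ennreal (exp (- (1/2) * (x \<bullet> (M *v x))))) \<in> borel_measurable borel"
    by (intro measurable_compose[OF _ measurable_ennreal] borel_measurable_continuous_onI continuous_intros
        linear_continuous_on matrix_vector_mul_bounded_linear)
  have "(\<integral>\<^sup>+x. ennreal (exp (- (1/2) * (x \<bullet> (M *v x)))) \<partial>lborel)
      = ennreal \<bar>det B\<bar> * (\<integral>\<^sup>+x. ennreal (exp (- (x \<bullet> x) / 2)) \<partial>(lborel :: (real^'n) measure))"
    by (subst nn_integral_lborel_linear[OF meas \<open>det B \<noteq> 0\<close>]) (simp add: quad)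
  also have "\<dots> = ennreal ((2 * pi) powr (real CARD('n) / 2) / sqrt (det M))"
    unfolding nn_integral_std_gaussian absB by (simp add: ennreal_mult''[symmetric])
  finally show ?thesis .
qed

lemma nn_integral_lborel_scale:
  fixes f :: "'a::euclidean_space \<Rightarrow> ennreal"
  assumes [measurable]: "f \<in> borel_measurable borel" and "c \<noteq> 0"
  shows "(\<integral>\<^sup>+x. f x \<partial>lborel) = ennreal (\<bar>c\<bar> ^ DIM('a)) * (\<integral>\<^sup>+x. f (t + c *\<^sub>R x) \<partial>lborel)"
proof -
  have "(\<integral>\<^sup>+x. f x \<partial>lborel) =
      (\<integral>\<^sup>+x. f x \<partial>density (distr lborel borel (\<lambda>x. t + c *\<^sub>R x)) (\<lambda>_. ennreal (\<bar>c\<bar> ^ DIM('a))))"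
    using lborel_affine[OF \<open>c \<noteq> 0\<close>, of t] by (rule arg_cong)
  also have "\<dots> = ennreal (\<bar>c\<bar> ^ DIM('a)) * (\<integral>\<^sup>+x. f (t + c *\<^sub>R x) \<partial>lborel)"
    by (simp add: nn_integral_density nn_integral_distr nn_integral_cmult)
  finally show ?thesis .
qed

lemma nn_integral_norm6_gaussian_finite:
  assumes b: "b > 0"
  shows "(\<integral>\<^sup>+x. ennreal (norm x ^ 6 * exp (- b * (norm x)\<^sup>2)) \<partial>(lborel :: (real^'n) measure)) < \<infinity>"
proof -
  have bound: "norm x ^ 6 * exp (- b * (norm x)\<^sup>2) \<le> 216 / b ^ 3 * exp (- (b / 2) * (norm x)\<^sup>2)" for x :: "real^'n"
  proof -
    \<comment> \<open>Half of the exponent is given up to absorb the polynomial: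
      \<open>z / 3 \<le> exp (z / 3)\<close> cubed yields \<open>z ^ 3 \<le> 27 * exp z\<close>, and
      \<open>norm x ^ 6\<close> is \<open>8 / b ^ 3 * z ^ 3\<close>; hence the constant 216.\<close>
    define z where "z = b * (norm x)\<^sup>2 / 2"
    have z: "z \<ge> 0" using b by (simp add: z_def)
    have "z / 3 \<le> exp (z / 3)"
      using exp_ge_add_one_self[of "z / 3"] by linarith
    then have "(z / 3) ^ 3 \<le> exp (z / 3) ^ 3"
      using z by (intro power_mono) auto
    also have "\<dots> = exp z" by (simp add: exp_of_nat_mult[symmetric])
    finally have "z ^ 3 \<le> 27 * exp z" by (simp add: power_divide)
    moreover have "norm x ^ 6 = 8 / b ^ 3 * z ^ 3"
      using b by (simp add: z_def power_mult_distrib power_divide power_mult[symmetric])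
    ultimately have "norm x ^ 6 \<le> 8 / b ^ 3 * (27 * exp z)"
      using b by (simp add: mult_left_mono divide_right_mono)
    then have "norm x ^ 6 * exp (- b * (norm x)\<^sup>2) \<le> 8 / b ^ 3 * (27 * exp z) * exp (- b * (norm x)\<^sup>2)"
      by (intro mult_right_mono) auto
    also have "\<dots> = 216 / b ^ 3 * exp (z + - b * (norm x)\<^sup>2)"
      by (simp add: exp_diff exp_minus field_simps)
    also have "z + - b * (norm x)\<^sup>2 = - (b / 2) * (norm x)\<^sup>2"
      by (simp add: z_def)
    finally show ?thesis .
  qed
  have "(\<integral>\<^sup>+x. ennreal (norm x ^ 6 * exp (- b * (norm x)\<^sup>2)) \<partial>(lborel :: (real^'n) measure))
      \<le> (\<integral>\<^sup>+x. ennreal (216 / b ^ 3) * ennreal (exp (- (b / 2) * (norm x)\<^sup>2)) \<partial>(lborel :: (real^'n) measure))"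
    using bound b by (intro nn_integral_mono) (simp add: ennreal_mult[symmetric] del: mult_minus_left)
  also have "\<dots> = ennreal (216 / b ^ 3) * (\<integral>\<^sup>+x. ennreal (exp (- (b / 2) * (norm x)\<^sup>2)) \<partial>(lborel :: (real^'n) measure))"
    by (intro nn_integral_cmult) simp
  also have "(\<integral>\<^sup>+x. ennreal (exp (- (b / 2) * (norm x)\<^sup>2)) \<partial>(lborel :: (real^'n) measure))
     = ennreal (\<bar>1 / sqrt b\<bar> ^ DIM(real^'n)) * (\<integral>\<^sup>+x. ennreal (exp (- (x \<bullet> x) / 2)) \<partial>(lborel :: (real^'n) measure))"
    using b
    by (subst nn_integral_lborel_scale[where c="1 / sqrt b" and t=0])
       (simp_all add: power_mult_distrib power_divide power2_norm_eq_inner)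
  finally show ?thesis
    unfolding nn_integral_std_gaussian by (simp add: ennreal_mult_less_top le_less_trans)
qed

text \<open>Substituting \<open>x = m + y / sqrt a\<close> makes the sixth power of the norm
  contribute \<open>a powr (- 3)\<close>, so that \<open>a\<^sup>2\<close> leaves one factor
  \<open>1 / a\<close>; the Jacobian supplies the rest of the exponent. With \<open>a = n\<close>
  this factor \<open>1 / a\<close> is the source of the rate.\<close>

lemma nn_integral_norm6_gaussian_scale:
  fixes m :: "real^'n"
  assumes a: "a > 0"
  shows "(\<integral>\<^sup>+x. ennreal (a\<^sup>2 * norm (x - m) ^ 6 * exp (- a * b * (norm (x - m))\<^sup>2)) \<partial>lborel)
    = ennreal (a powr (- 1 - real CARD('n) / 2))
       * (\<integral>\<^sup>+x. ennreal (norm x ^ 6 * exp (- b * (norm x)\<^sup>2)) \<partial>(lborel :: (real^'n) measure))"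
proof -
  have "(\<integral>\<^sup>+x. ennreal (a\<^sup>2 * norm (x - m) ^ 6 * exp (- a * b * (norm (x - m))\<^sup>2)) \<partial>lborel)
    = ennreal (\<bar>1 / sqrt a\<bar> ^ DIM(real^'n)) * (\<integral>\<^sup>+x. ennreal (a\<^sup>2 * norm ((m + (1 / sqrt a) *\<^sub>R x) - m) ^ 6
         * exp (- a * b * (norm ((m + (1 / sqrt a) *\<^sub>R x) - m))\<^sup>2)) \<partial>(lborel :: (real^'n) measure))"
    using a by (intro nn_integral_lborel_scale) auto
  also have "(\<integral>\<^sup>+x. ennreal (a\<^sup>2 * norm ((m + (1 / sqrt a) *\<^sub>R x) - m) ^ 6
         * exp (- a * b * (norm ((m + (1 / sqrt a) *\<^sub>R x) - m))\<^sup>2)) \<partial>(lborel :: (real^'n) measure))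
     = (\<integral>\<^sup>+x. ennreal (1 / a) * ennreal (norm x ^ 6 * exp (- b * (norm x)\<^sup>2)) \<partial>(lborel :: (real^'n) measure))"
  proof (rule nn_integral_cong)
    fix x :: "real^'n"
    have "sqrt a ^ 6 = a ^ 3" using a by (simp add: real_sqrt_power_even)
    then have "a\<^sup>2 * norm ((m + (1 / sqrt a) *\<^sub>R x) - m) ^ 6 = 1 / a * norm x ^ 6"
      using a by (simp add: power_divide power2_eq_square power3_eq_cube)
    moreover have "- a * b * (norm ((m + (1 / sqrt a) *\<^sub>R x) - m))\<^sup>2 = - b * (norm x)\<^sup>2"
      using a by (simp add: power_divide)
    ultimately show "ennreal (a\<^sup>2 * norm ((m + (1 / sqrt a) *\<^sub>R x) - m) ^ 6
         * exp (- a * b * (norm ((m + (1 / sqrt a) *\<^sub>R x) - m))\<^sup>2))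
       = ennreal (1 / a) * ennreal (norm x ^ 6 * exp (- b * (norm x)\<^sup>2))"
      using a by (simp only: ennreal_mult[symmetric] mult.assoc)
         (simp add: ennreal_mult[symmetric])
  qed
  also have "\<dots> = ennreal (1 / a) * (\<integral>\<^sup>+x. ennreal (norm x ^ 6 * exp (- b * (norm x)\<^sup>2)) \<partial>(lborel :: (real^'n) measure))"
    by (intro nn_integral_cmult) simp
  also have "ennreal (\<bar>1 / sqrt a\<bar> ^ DIM(real^'n)) * (ennreal (1 / a) * X) = ennreal (a powr (- 1 - real CARD('n) / 2)) * X" for X
  proof -
    have "\<bar>1 / sqrt a\<bar> ^ DIM(real^'n) * (1 / a) = (a powr (- 1 / 2)) powr (real CARD('n)) * a powr (- 1)"
      using a by (simp add: powr_realpow powr_minus_divide powr_half_sqrt)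
    also have "\<dots> = a powr (- 1 - real CARD('n) / 2)"
      unfolding powr_powr powr_add[symmetric] by (simp add: algebra_simps)
    finally show ?thesis
      using a by (simp add: mult.assoc[symmetric] ennreal_mult[symmetric])
  qed
  finally show ?thesis .
qed

text \<open>\<open>matrix_inv\<close> is a Hilbert choice of a two-sided inverse; for square
  matrices a right inverse is already two-sided and pins the choice down.\<close>

lemma matrix_inv_eqI:
  fixes A B :: "real^'n^'n"
  assumes "A ** B = mat 1"
  shows "matrix_inv A = B"
proof -
  have BA: "B ** A = mat 1" using assms by (simp add: matrix_left_right_inverse)
  then have "A ** matrix_inv A = mat 1 \<and> matrix_inv A ** A = mat 1"
    unfolding matrix_inv_def using assms by (rule someI[of _ B, OF conjI, rotated])
  then have "B = (matrix_inv A ** A) ** B" by simp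
  also have "\<dots> = matrix_inv A"
    unfolding matrix_mul_assoc[symmetric] assms by simp
  finally show ?thesis by simp
qed

lemma det_scaleR:
  fixes A :: "real^'n^'n"
  shows "det (c *\<^sub>R A) = c ^ CARD('n) * det A"
proof -
  have "c *\<^sub>R A = (\<chi> i. c *s A $ i)" by (simp add: vec_eq_iff)
  then show ?thesis using det_rows_mul[of "\<lambda>_. c" "\<lambda>i. A $ i"] by simp
qed

text \<open>\<open>gaussian\<close> takes a covariance, whereas all estimates concern the precision
  matrix \<open>a *\<^sub>R H\<close>; inverting the covariance gives it back because
  \<open>det H > 0\<close>. \<open>W\<close> is the mass of the unnormalised Gaussian
  \<open>h\<close>.\<close>

lemma gaussian_precision:
  fixes m :: "real^'n" and H :: "real^'n^'n"
  assumes pd: "posdef H" and sym: "transpose H = H" and a: "a > 0"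
  defines "W \<equiv> (2 * pi) powr (real CARD('n) / 2) * a powr (- real CARD('n) / 2) / sqrt (det H)"
  defines "h \<equiv> \<lambda>x. exp (- (a / 2) * ((x - m) \<bullet> (H *v (x - m))))"
  shows "gaussian m ((1 / a) *\<^sub>R matrix_inv H) = density lborel (\<lambda>x. ennreal (h x / W))"
    and "(\<integral>\<^sup>+x. ennreal (h x) \<partial>lborel) = ennreal W"
proof -
  have dH: "det H > 0" using posdef_det_pos[OF pd sym] .
  then obtain H' where H': "H ** H' = mat 1" "H' ** H = mat 1"
    using invertible_det_nz[of H] unfolding invertible_def by auto
  have inv: "matrix_inv H = H'" using matrix_inv_eqI[OF H'(1)] .
  have "((1 / a) *\<^sub>R H') ** (a *\<^sub>R H) = mat 1"
    using a H' by (simp add: scalar_matrix_assoc[symmetric] matrix_scalar_ac)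
  then have inv2: "matrix_inv ((1 / a) *\<^sub>R H') = a *\<^sub>R H" by (rule matrix_inv_eqI)
  have "det H * det H' = 1" using H' by (metis det_I det_mul)
  then have dH': "det H' = 1 / det H" using dH by (simp add: field_simps)
  have sqrtpow: "sqrt ((1 / a) ^ CARD('n)) = a powr (- real CARD('n) / 2)"
  proof -
    have "(1 / a) ^ CARD('n) = a powr (- real CARD('n))"
      using a by (simp add: powr_minus powr_realpow power_divide inverse_eq_divide)
    then show ?thesis using a by (simp add: powr_half_sqrt[symmetric] powr_powr)
  qed
  have scale: "(x - m) \<bullet> ((a *\<^sub>R H) *v (x - m)) = a * ((x - m) \<bullet> (H *v (x - m)))" for x
    by (simp add: scaleR_matrix_vector_assoc[symmetric])
  have const: "(2 * pi) powr (- real CARD('n) / 2) / sqrt (det ((1 / a) *\<^sub>R H')) = 1 / W"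
    unfolding W_def det_scaleR dH' real_sqrt_mult sqrtpow
    using dH by (simp add: real_sqrt_divide powr_minus field_simps)
  show "gaussian m ((1 / a) *\<^sub>R matrix_inv H) = density lborel (\<lambda>x. ennreal (h x / W))"
    unfolding gaussian_def inv inv2 const scale h_def
    by (simp add: mult.assoc)
  have cont: "continuous_on UNIV (\<lambda>x::real^'n. exp (- (a / 2) * ((x - m) \<bullet> (H *v (x - m)))))"
    by (intro continuous_intros linear_continuous_on_compose[OF _ matrix_vector_mul_linear])
  have [measurable]: "h \<in> borel_measurable borel"
    unfolding h_def by (rule borel_measurable_continuous_onI[OF cont])
  have "(\<integral>\<^sup>+x. ennreal (h x) \<partial>lborel)
      = ennreal (\<bar>1 / sqrt a\<bar> ^ DIM(real^'n)) * (\<integral>\<^sup>+x. ennreal (h (m + (1 / sqrt a) *\<^sub>R x)) \<partial>lborel)"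
    using a by (intro nn_integral_lborel_scale) auto
  also have "(\<lambda>x. h (m + (1 / sqrt a) *\<^sub>R x)) = (\<lambda>x. exp (- (1/2) * (x \<bullet> (H *v x))))"
    using a by (simp add: h_def linear_scale[OF matrix_vector_mul_linear])
  also have "(\<integral>\<^sup>+x. ennreal (exp (- (1/2) * (x \<bullet> (H *v x)))) \<partial>lborel) = ennreal ((2 * pi) powr (real CARD('n) / 2) / sqrt (det H))"
    by (rule nn_integral_gaussian_quadratic[OF pd sym])
  also have "\<bar>1 / sqrt a\<bar> ^ DIM(real^'n) = a powr (- real CARD('n) / 2)"
    using a sqrtpow by (simp add: real_sqrt_power real_sqrt_divide)
  finally show "(\<integral>\<^sup>+x. ennreal (h x) \<partial>lborel) = ennreal W"
    using dH by (simp add: W_def ennreal_mult[symmetric] mult.commute)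
qed

section \<open>Iterated derivatives\<close>

text \<open>On a set that is not open the derivatives are only derivatives within the set;
  restriction to an open subset turns them into ordinary ones.\<close>

lemma has_derivs_on_subset:
  assumes "has_derivs_on k S f D" and "T \<subseteq> S"
  shows "has_derivs_on k T f D"
  unfolding has_derivs_on_def
proof (intro conjI allI impI ballI)
  show "D 0 x [] = f x" if "x \<in> T" for x
    using assms that by (auto simp: has_derivs_on_def)
  show "((\<lambda>y. D j y hs) has_derivative (\<lambda>h. D (Suc j) x (h # hs))) (at x within T)"
    if "j < k" "x \<in> T" "length hs = j" for j x hs
    using assms that by (intro has_derivative_subset[OF _ assms(2)]) (auto simp: has_derivs_on_def)
  show "continuous_on T (\<lambda>y. D k y hs)" if "length hs = k" for hs
    using assms that by (intro continuous_on_subset[OF _ assms(2)]) (auto simp: has_derivs_on_def)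
qed

lemma has_derivs_on_0: "has_derivs_on k S f D \<Longrightarrow> x \<in> S \<Longrightarrow> D 0 x [] = f x"
  by (simp add: has_derivs_on_def)

lemma has_derivs_on_Suc:
  assumes "has_derivs_on k S f D" "open S" "x \<in> S" "length hs = j" "j < k"
  shows "((\<lambda>y. D j y hs) has_derivative (\<lambda>h. D (Suc j) x (h # hs))) (at x)"
proof -
  have "((\<lambda>y. D j y hs) has_derivative (\<lambda>h. D (Suc j) x (h # hs))) (at x within S)"
    using assms by (simp add: has_derivs_on_def)
  then show ?thesis by (simp only: at_within_open[OF assms(3,2)])
qed

text \<open>Functions that agree on an open set have the same derivative there, so equality
  propagates from order \<open>j\<close> to \<open>Suc j\<close>. This ties together derivative
  families that are given independently of each other.\<close>

lemma has_derivs_on_unique: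
  assumes S: "open S" and D: "has_derivs_on k S f D" and E: "has_derivs_on k S f E"
    and "j \<le> k" "x \<in> S" "length hs = j"
  shows "D j x hs = E j x hs"
  using assms(4-)
proof (induction j arbitrary: x hs)
  case 0
  then show ?case using D E by (simp add: has_derivs_on_def)
next
  case (Suc j)
  then obtain h hs' where hs: "hs = h # hs'" "length hs' = j"
    by (cases hs) auto
  have "((\<lambda>y. D j y hs') has_derivative (\<lambda>h. D (Suc j) x (h # hs'))) (at x)"
    using has_derivs_on_Suc[OF D S] Suc.prems hs by simp
  moreover have "((\<lambda>y. D j y hs') has_derivative (\<lambda>h. E (Suc j) x (h # hs'))) (at x)"
  proof (rule has_derivative_transform_within_open[OF _ S])
    show "((\<lambda>y. E j y hs') has_derivative (\<lambda>h. E (Suc j) x (h # hs'))) (at x)"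
      using has_derivs_on_Suc[OF E S] Suc.prems hs by simp
    show "E j y hs' = D j y hs'" if "y \<in> S" for y
      using Suc.IH[OF _ that hs(2)] Suc.prems by simp
  qed (use Suc.prems in auto)
  ultimately have "(\<lambda>h. D (Suc j) x (h # hs')) = (\<lambda>h. E (Suc j) x (h # hs'))"
    by (rule has_derivative_unique)
  then show ?case unfolding hs by (rule fun_cong)
qed

lemma has_derivs_on_diff_scaled:
  assumes "has_derivs_on k S f D" "has_derivs_on k S g E"
  shows "has_derivs_on k S (\<lambda>x. f x - c * g x) (\<lambda>j x hs. D j x hs - c * E j x hs)"
  using assms unfolding has_derivs_on_def
  by (auto intro!: continuous_intros has_derivative_diff has_derivative_mult_right)

text \<open>The definition makes only the head slot linear, as the argument of a derivative. For a
  later slot, the value is the derivative, in the head direction, of a map that depends linearly on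
  that slot by induction, and uniqueness of derivatives carries the linearity over.\<close>

lemma has_derivs_on_linear:
  assumes S: "open S" and D: "has_derivs_on k S f D"
    and "x \<in> S" "length as + length bs = j" "j < k"
  shows "linear (\<lambda>h. D (Suc j) x (as @ h # bs))"
  using assms(3-)
proof (induction as arbitrary: j x)
  case Nil
  then have "((\<lambda>y. D j y bs) has_derivative (\<lambda>h. D (Suc j) x (h # bs))) (at x)"
    by (intro has_derivs_on_Suc[OF D S]) auto
  then show ?case by (simp add: has_derivative_linear)
next
  case (Cons a as)
  then obtain i where j: "j = Suc i" and i: "length as + length bs = i" "i < k"
    by (cases j) auto
  have lin: "linear (\<lambda>h. D j y (as @ h # bs))" if "y \<in> S" for y
    unfolding j using Cons.IH[OF that i] .
  have der: "((\<lambda>y. D j y (as @ h # bs)) has_derivative (\<lambda>a. D (Suc j) x (a # as @ h # bs))) (at x)" for h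
    using Cons.prems j by (intro has_derivs_on_Suc[OF D S]) auto
  show ?case
  proof (rule linearI)
    fix h h'
    have "((\<lambda>y. D j y (as @ (h + h') # bs)) has_derivative
        (\<lambda>a. D (Suc j) x (a # as @ h # bs) + D (Suc j) x (a # as @ h' # bs))) (at x)"
      using has_derivative_add[OF der der]
      by (rule has_derivative_transform_within_open[OF _ S Cons.prems(1)]) (simp add: linear_add[OF lin])
    from fun_cong[OF has_derivative_unique[OF der this], of a]
    show "D (Suc j) x ((a # as) @ (h + h') # bs) = D (Suc j) x ((a # as) @ h # bs) + D (Suc j) x ((a # as) @ h' # bs)"
      by simp
  next
    fix c h
    have "((\<lambda>y. D j y (as @ (c *\<^sub>R h) # bs)) has_derivative
        (\<lambda>a. c * D (Suc j) x (a # as @ h # bs))) (at x)"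
      using has_derivative_mult_right[OF der]
      by (rule has_derivative_transform_within_open[OF _ S Cons.prems(1)]) (simp add: linear_scale[OF lin])
    from fun_cong[OF has_derivative_unique[OF der this], of a]
    show "D (Suc j) x ((a # as) @ (c *\<^sub>R h) # bs) = c *\<^sub>R D (Suc j) x ((a # as) @ h # bs)"
      by simp
  qed
qed

lemma has_derivs_on_directional:
  assumes S: "open S" and D: "has_derivs_on k S f D"
    and "x + t *\<^sub>R v \<in> S" "length hs = j" "j < k"
  shows "((\<lambda>t. D j (x + t *\<^sub>R v) hs) has_real_derivative D (Suc j) (x + t *\<^sub>R v) (v # hs)) (at t)"
proof -
  have der: "((\<lambda>y. D j y hs) has_derivative (\<lambda>h. D (Suc j) (x + t *\<^sub>R v) (h # hs))) (at (x + t *\<^sub>R v))"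
    using assms by (intro has_derivs_on_Suc[OF D S])
  have "((\<lambda>t. x + t *\<^sub>R v) has_derivative (\<lambda>s. s *\<^sub>R v)) (at t)"
    by (auto intro!: derivative_eq_intros)
  from has_derivative_compose[OF this der]
  have "((\<lambda>t. D j (x + t *\<^sub>R v) hs) has_derivative (\<lambda>s. D (Suc j) (x + t *\<^sub>R v) ((s *\<^sub>R v) # hs))) (at t)" .
  moreover have "D (Suc j) (x + t *\<^sub>R v) ((s *\<^sub>R v) # hs) = D (Suc j) (x + t *\<^sub>R v) (v # hs) * s" for s
    using linear_scale[OF has_derivative_linear[OF der]] by simp
  ultimately show ?thesis
    by (simp add: has_field_derivative_def)
qed

text \<open>The mean value theorem is applied along \<open>h\<close> to a difference of two values
  shifted by \<open>t *\<^sub>R h'\<close>, and then along \<open>h'\<close>; the latest direction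
  stands first, hence \<open>[h', h]\<close>. The second difference itself is symmetric in
  \<open>h\<close> and \<open>h'\<close>, which is the source of Schwarz's theorem.\<close>

lemma second_difference_mean_value:
  assumes D: "has_derivs_on k (ball x e) f D" and "2 \<le> k"
    and t: "0 < t" "t * (norm h + norm h') < e"
  shows "\<exists>y. dist x y \<le> t * (norm h + norm h') \<and>
    f (x + t *\<^sub>R h + t *\<^sub>R h') - f (x + t *\<^sub>R h) - f (x + t *\<^sub>R h') + f x = t\<^sup>2 * D 2 y [h', h]"
proof -
  have near: "dist x (x + s *\<^sub>R h + r *\<^sub>R h') \<le> t * (norm h + norm h')" if "0 \<le> s" "s \<le> t" "0 \<le> r" "r \<le> t" for s r
  proof -
    have "norm (s *\<^sub>R h + r *\<^sub>R h') \<le> s * norm h + r * norm h'"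
      using that norm_triangle_ineq[of "s *\<^sub>R h" "r *\<^sub>R h'"] by simp
    also have "\<dots> \<le> t * norm h + t * norm h'"
      using that by (intro add_mono mult_right_mono) auto
    finally have "norm (s *\<^sub>R h + r *\<^sub>R h') \<le> t * (norm h + norm h')"
      by (simp add: distrib_left)
    moreover have "dist x (x + s *\<^sub>R h + r *\<^sub>R h') = norm (s *\<^sub>R h + r *\<^sub>R h')"
      unfolding dist_commute[of x] by (simp add: dist_norm add.assoc)
    ultimately show ?thesis by simp
  qed
  have inb: "x + s *\<^sub>R h + r *\<^sub>R h' \<in> ball x e" if "0 \<le> s" "s \<le> t" "0 \<le> r" "r \<le> t" for s r
    using near[OF that] t by simp
  have D0: "D 0 y [] = f y" if "y \<in> ball x e" for y
    using has_derivs_on_0[OF D that] .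
  have "\<exists>s. 0 < s \<and> s < t \<and>
     (D 0 ((x + t *\<^sub>R h') + t *\<^sub>R h) [] - D 0 (x + t *\<^sub>R h) [])
       - (D 0 ((x + t *\<^sub>R h') + 0 *\<^sub>R h) [] - D 0 (x + 0 *\<^sub>R h) []) =
     (t - 0) * (D (Suc 0) ((x + t *\<^sub>R h') + s *\<^sub>R h) [h] - D (Suc 0) (x + s *\<^sub>R h) [h])"
  proof (rule MVT2[OF t(1)])
    fix s assume s: "0 \<le> s" "s \<le> t"
    show "((\<lambda>s. D 0 ((x + t *\<^sub>R h') + s *\<^sub>R h) [] - D 0 (x + s *\<^sub>R h) []) has_real_derivative
        D (Suc 0) ((x + t *\<^sub>R h') + s *\<^sub>R h) [h] - D (Suc 0) (x + s *\<^sub>R h) [h]) (at s)"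
      using inb[OF s, of t] inb[OF s, of 0] t(1) \<open>2 \<le> k\<close>
      by (intro DERIV_diff has_derivs_on_directional[OF open_ball D]) (auto simp: add_ac)
  qed
  then obtain s where s: "0 < s" "s < t" and eq1:
    "f (x + t *\<^sub>R h + t *\<^sub>R h') - f (x + t *\<^sub>R h) - f (x + t *\<^sub>R h') + f x
      = t * (D (Suc 0) ((x + s *\<^sub>R h) + t *\<^sub>R h') [h] - D (Suc 0) ((x + s *\<^sub>R h) + 0 *\<^sub>R h') [h])"
    using D0[OF inb[of t t]] D0[OF inb[of t 0]] D0[OF inb[of 0 t]] D0[OF inb[of 0 0]] t(1)
    by (auto simp: add_ac)
  have "\<exists>r. 0 < r \<and> r < t \<and>
    D (Suc 0) ((x + s *\<^sub>R h) + t *\<^sub>R h') [h] - D (Suc 0) ((x + s *\<^sub>R h) + 0 *\<^sub>R h') [h]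
     = (t - 0) * D (Suc (Suc 0)) ((x + s *\<^sub>R h) + r *\<^sub>R h') [h', h]"
  proof (rule MVT2[OF t(1)])
    fix r assume r: "0 \<le> r" "r \<le> t"
    show "((\<lambda>r. D (Suc 0) ((x + s *\<^sub>R h) + r *\<^sub>R h') [h]) has_real_derivative
        D (Suc (Suc 0)) ((x + s *\<^sub>R h) + r *\<^sub>R h') [h', h]) (at r)"
      using inb[of s r] r s \<open>2 \<le> k\<close>
      by (intro has_derivs_on_directional[OF open_ball D]) auto
  qed
  then obtain r where r: "0 < r" "r < t" and eq2:
    "D (Suc 0) ((x + s *\<^sub>R h) + t *\<^sub>R h') [h] - D (Suc 0) ((x + s *\<^sub>R h) + 0 *\<^sub>R h') [h]
     = t * D 2 ((x + s *\<^sub>R h) + r *\<^sub>R h') [h', h]"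
    by (auto simp: numeral_2_eq_2)
  show ?thesis
    using near[of s r] s r eq1 eq2
    by (intro exI[of _ "x + s *\<^sub>R h + r *\<^sub>R h'"]) (auto simp: power2_eq_square)
qed

lemma has_derivs_on_isCont:
  assumes D: "has_derivs_on k S f D" and "open S" "x \<in> S" "length hs = j" "j \<le> k"
  shows "isCont (\<lambda>y. D j y hs) x"
proof (cases "j = k")
  case True
  then have "continuous_on S (\<lambda>y. D j y hs)"
    using D assms(4) by (simp add: has_derivs_on_def)
  then show ?thesis using assms(2,3) by (simp add: continuous_on_eq_continuous_at)
next
  case False
  then show ?thesis
    using has_derivs_on_Suc[OF D assms(2-4)] assms(5) has_derivative_continuous by fastforce
qed

text \<open>Schwarz's theorem: one second difference over a small parallelogram, read in both
  orders, is \<open>t\<^sup>2\<close> times the form at two points close to \<open>x\<close>, and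
  continuity of \<open>D 2\<close> brings both points to \<open>x\<close>.\<close>

lemma second_derivative_symmetric:
  assumes S: "open S" and D: "has_derivs_on k S f D" and "2 \<le> k" "x \<in> S"
  shows "D 2 x [h, h'] = D 2 x [h', h]"
proof -
  obtain e where e: "e > 0" "ball x e \<subseteq> S"
    using S \<open>x \<in> S\<close> open_contains_ball by blast
  note D' = has_derivs_on_subset[OF D e(2)]
  have close: "dist (D 2 x [h, h']) (D 2 x [h', h]) < \<epsilon>" if "\<epsilon> > 0" for \<epsilon>
  proof -
    have cont: "isCont (\<lambda>y. D 2 y hs) x" if "length hs = 2" for hs
      using has_derivs_on_isCont[OF D S \<open>x \<in> S\<close> that] \<open>2 \<le> k\<close> by simp
    obtain d1 where d1: "d1 > 0" "\<And>y. dist y x < d1 \<Longrightarrow> dist (D 2 y [h', h]) (D 2 x [h', h]) < \<epsilon> / 2"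
      using cont[of "[h', h]"] \<open>\<epsilon> > 0\<close> unfolding continuous_at_eps_delta
      by (auto dest!: spec[of _ "\<epsilon>/2"])
    obtain d2 where d2: "d2 > 0" "\<And>y. dist y x < d2 \<Longrightarrow> dist (D 2 y [h, h']) (D 2 x [h, h']) < \<epsilon> / 2"
      using cont[of "[h, h']"] \<open>\<epsilon> > 0\<close> unfolding continuous_at_eps_delta
      by (auto dest!: spec[of _ "\<epsilon>/2"])
    define m :: real where "m = min e (min d1 d2)"
    \<comment> \<open>The summand \<open>1\<close> keeps \<open>N\<close> positive when both
      directions vanish; \<open>t\<close> is then small enough that both mean value points lie in
      the ball and within the two continuity radii.\<close>
    define N where "N = norm h + norm h' + 1"
    define t where "t = m / (2 * N)"
    have m: "m > 0" using e d1 d2 by (simp add: m_def)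
    have pos: "N > 0" by (simp add: N_def add_nonneg_pos)
    have t: "t > 0" using m pos by (simp add: t_def)
    have "t * (norm h + norm h') \<le> t * N"
      using t by (intro mult_left_mono) (auto simp: N_def)
    also have "\<dots> = m / 2" using pos by (simp add: t_def)
    also have "\<dots> < m" using m by simp
    finally have tm: "t * (norm h + norm h') < m" .
    then have tm': "t * (norm h' + norm h) < m" by (simp only: add.commute)
    have te: "t * (norm h + norm h') < e" "t * (norm h' + norm h) < e"
      using tm tm' unfolding m_def by linarith+
    have td: "t * (norm h + norm h') < d1" "t * (norm h' + norm h) < d2"
      using tm tm' unfolding m_def by linarith+
    obtain y where y: "dist x y \<le> t * (norm h + norm h')"
        "f (x + t *\<^sub>R h + t *\<^sub>R h') - f (x + t *\<^sub>R h) - f (x + t *\<^sub>R h') + f x = t\<^sup>2 * D 2 y [h', h]"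
      using second_difference_mean_value[OF D' \<open>2 \<le> k\<close> t te(1)] by blast
    obtain z where z: "dist x z \<le> t * (norm h' + norm h)"
        "f (x + t *\<^sub>R h' + t *\<^sub>R h) - f (x + t *\<^sub>R h') - f (x + t *\<^sub>R h) + f x = t\<^sup>2 * D 2 z [h, h']"
      using second_difference_mean_value[OF D' \<open>2 \<le> k\<close> t te(2)] by blast
    have "f (x + t *\<^sub>R h + t *\<^sub>R h') - f (x + t *\<^sub>R h) - f (x + t *\<^sub>R h') + f x
        = f (x + t *\<^sub>R h' + t *\<^sub>R h) - f (x + t *\<^sub>R h') - f (x + t *\<^sub>R h) + f x"
      by (simp add: add_ac)
    then have "t\<^sup>2 * D 2 y [h', h] = t\<^sup>2 * D 2 z [h, h']"
      using y(2) z(2) by (simp only:)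
    then have eq: "D 2 y [h', h] = D 2 z [h, h']" using t by simp
    have "dist (D 2 y [h', h]) (D 2 x [h', h]) < \<epsilon> / 2" "dist (D 2 z [h, h']) (D 2 x [h, h']) < \<epsilon> / 2"
      using y(1) z(1) td d1(2)[of y] d2(2)[of z] by (simp_all add: dist_commute)
    then show ?thesis unfolding eq dist_real_def by linarith
  qed
  show ?thesis
    using close[of "dist (D 2 x [h, h']) (D 2 x [h', h])"] by (cases "D 2 x [h, h'] = D 2 x [h', h]") auto
qed

text \<open>Maclaurin's formula along the segment: the derivative of order \<open>m\<close> in the
  line parameter is \<open>D m\<close> with the direction \<open>v\<close> repeated \<open>m\<close>
  times.\<close>

lemma has_derivs_on_Taylor3:
  assumes S: "open S" and D: "has_derivs_on 3 S f D"
    and seg: "\<And>t. 0 \<le> t \<Longrightarrow> t \<le> 1 \<Longrightarrow> x + t *\<^sub>R v \<in> S"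
  shows "\<exists>t. 0 < t \<and> t < 1 \<and>
    f (x + v) = f x + D 1 x [v] + D 2 x [v, v] / 2 + D 3 (x + t *\<^sub>R v) [v, v, v] / 6"
proof -
  have "\<exists>t::real. 0 < t \<and> t < 1 \<and> D 0 (x + 1 *\<^sub>R v) (replicate 0 v) =
      (\<Sum>m<3. D m (x + 0 *\<^sub>R v) (replicate m v) / fact m * 1 ^ m)
       + D 3 (x + t *\<^sub>R v) (replicate 3 v) / fact 3 * 1 ^ 3"
    by (rule Maclaurin[where diff="\<lambda>m t. D m (x + t *\<^sub>R v) (replicate m v)"])
       (auto intro!: has_derivs_on_directional[OF S D] seg)
  then show ?thesis
    using has_derivs_on_0[OF D seg[of 0]] has_derivs_on_0[OF D seg[of 1]]
    by (auto simp: eval_nat_numeral)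
qed

text \<open>A crude bound whose purpose is finiteness: applied slot by slot, it bounds a trilinear
  form on unit vectors by its values on basis triples.\<close>

lemma linear_abs_le_sum_Basis:
  fixes g :: "'a::euclidean_space \<Rightarrow> real"
  assumes "linear g" "norm a \<le> 1"
  shows "\<bar>g a\<bar> \<le> (\<Sum>i\<in>Basis. \<bar>g i\<bar>)"
proof -
  have "g a = g (\<Sum>i\<in>Basis. (a \<bullet> i) *\<^sub>R i)" by (simp add: euclidean_representation)
  also have "\<dots> = (\<Sum>i\<in>Basis. (a \<bullet> i) * g i)"
    by (simp add: linear_sum[OF assms(1)] linear_scale[OF assms(1)])
  also have "\<bar>\<dots>\<bar> \<le> (\<Sum>i\<in>Basis. \<bar>(a \<bullet> i) * g i\<bar>)" by (rule sum_abs)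
  also have "\<dots> \<le> (\<Sum>i\<in>Basis. \<bar>g i\<bar>)"
  proof (rule sum_mono)
    fix i :: 'a assume "i \<in> Basis"
    then have "\<bar>a \<bullet> i\<bar> \<le> 1" using Basis_le_norm[of i a] assms(2) by simp
    then show "\<bar>(a \<bullet> i) * g i\<bar> \<le> \<bar>g i\<bar>" by (simp add: abs_mult mult_left_le_one_le)
  qed
  finally show ?thesis .
qed

text \<open>Without multilinearity \<^const>\<open>opnorm3\<close> could be a supremum of an unbounded set, hence arbitrary.\<close>

lemma abs_le_opnorm3:
  fixes T :: "'a::euclidean_space list \<Rightarrow> real"
  assumes l1: "\<And>b c. linear (\<lambda>a. T [a, b, c])" and l2: "\<And>a c. linear (\<lambda>b. T [a, b, c])"
    and l3: "\<And>a b. linear (\<lambda>c. T [a, b, c])"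
  shows "\<bar>T [v, v, v]\<bar> \<le> opnorm3 T * norm v ^ 3"
proof -
  let ?A = "{\<bar>T [h1, h2, h3]\<bar> | h1 h2 h3. norm h1 \<le> 1 \<and> norm h2 \<le> 1 \<and> norm h3 \<le> 1}"
  have bdd: "bdd_above ?A"
  proof (rule bdd_aboveI)
    fix y assume "y \<in> ?A"
    then obtain a b c where y: "y = \<bar>T [a, b, c]\<bar>" and n: "norm a \<le> 1" "norm b \<le> 1" "norm c \<le> 1"
      by blast
    have "y \<le> (\<Sum>i\<in>Basis. \<bar>T [i, b, c]\<bar>)"
      unfolding y using linear_abs_le_sum_Basis[OF l1 n(1)] .
    also have "\<dots> \<le> (\<Sum>i\<in>Basis. \<Sum>j\<in>Basis. \<bar>T [i, j, c]\<bar>)"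
      using linear_abs_le_sum_Basis[OF l2 n(2)] by (intro sum_mono)
    also have "\<dots> \<le> (\<Sum>i\<in>Basis. \<Sum>j\<in>Basis. \<Sum>k\<in>Basis. \<bar>T [i, j, k]\<bar>)"
      using linear_abs_le_sum_Basis[OF l3 n(3)] by (intro sum_mono)
    finally show "y \<le> (\<Sum>i\<in>Basis. \<Sum>j\<in>Basis. \<Sum>k\<in>Basis. \<bar>T [i, j, k]\<bar>)" .
  qed
  \<comment> \<open>For \<open>v = 0\<close> the convention \<open>inverse 0 = 0\<close> gives
    \<open>u = 0\<close>, so both \<open>v = norm v *\<^sub>R u\<close> and
    \<open>norm u \<le> 1\<close> hold in every case.\<close>
  define u where "u = v /\<^sub>R norm v"
  have v: "v = norm v *\<^sub>R u" by (cases "v = 0") (auto simp: u_def)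
  have "norm u \<le> 1" by (cases "v = 0") (auto simp: u_def)
  then have "\<bar>T [u, u, u]\<bar> \<le> opnorm3 T"
    unfolding opnorm3_def by (intro cSup_upper[OF _ bdd]) blast
  moreover have "T [v, v, v] = norm v ^ 3 * T [u, u, u]"
  proof -
    have "T [v, v, v] = T [norm v *\<^sub>R u, norm v *\<^sub>R u, norm v *\<^sub>R u]"
      by (simp only: v[symmetric])
    also have "\<dots> = norm v ^ 3 * T [u, u, u]"
      by (simp add: linear_scale[OF l1] linear_scale[OF l2] linear_scale[OF l3] power3_eq_cube)
    finally show ?thesis .
  qed
  ultimately show ?thesis
    using mult_right_mono[of "\<bar>T [u, u, u]\<bar>" "opnorm3 T" "norm v ^ 3"] by (simp add: abs_mult mult.commute)
qed

lemma third_derivative_le_opnorm3: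
  fixes D :: "nat \<Rightarrow> 'a::euclidean_space \<Rightarrow> 'a list \<Rightarrow> real"
  assumes "open S" "has_derivs_on 3 S f D" "x \<in> S"
  shows "\<bar>D 3 x [v, v, v]\<bar> \<le> opnorm3 (D 3 x) * norm v ^ 3"
proof (rule abs_le_opnorm3)
  have lin: "linear (\<lambda>h. D 3 x (as @ h # bs))" if "length as + length bs = 2" for as bs
    using has_derivs_on_linear[OF assms that] by (simp add: numeral_3_eq_3)
  show "linear (\<lambda>a. D 3 x [a, b, c])" for b c using lin[of "[]" "[b, c]"] by simp
  show "linear (\<lambda>b. D 3 x [a, b, c])" for a c using lin[of "[a]" "[c]"] by simp
  show "linear (\<lambda>c. D 3 x [a, b, c])" for a b using lin[of "[a, b]" "[]"] by simp
qed

lemma hess_mat_quadratic_form: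
  fixes D :: "nat \<Rightarrow> real^'n \<Rightarrow> (real^'n) list \<Rightarrow> real"
  assumes "open S" "has_derivs_on k S f D" "x \<in> S" "2 \<le> k"
  shows "D 2 x [v, w] = v \<bullet> (hess_mat (D 2) x *v w)"
proof -
  have lin: "linear (\<lambda>h. D 2 x (as @ h # bs))" if "length as + length bs = 1" for as bs
    using has_derivs_on_linear[OF assms(1-3) that] assms(4) by (simp add: numeral_2_eq_2)
  have l1: "linear (\<lambda>a. D 2 x [a, b])" for b using lin[of "[]" "[b]"] by simp
  have l2: "linear (\<lambda>b. D 2 x [a, b])" for a using lin[of "[a]" "[]"] by simp
  have expand: "g v = (\<Sum>i\<in>UNIV. v $ i * g (axis i 1))" if "linear g" for g :: "real^'n \<Rightarrow> real" and v
  proof -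
    have "g v = g (\<Sum>i\<in>UNIV. v $ i *\<^sub>R axis i 1)"
      by (metis basis_expansion scalar_mult_eq_scaleR)
    then show ?thesis by (simp add: linear_sum[OF that] linear_scale[OF that])
  qed
  have "D 2 x [v, w] = (\<Sum>i\<in>UNIV. v $ i * D 2 x [axis i 1, w])"
    by (rule expand[OF l1])
  also have "\<dots> = (\<Sum>i\<in>UNIV. v $ i * (\<Sum>j\<in>UNIV. w $ j * D 2 x [axis i 1, axis j 1]))"
    by (subst expand[OF l2]) simp
  finally show ?thesis
    by (simp add: inner_vec_def matrix_vector_mult_def hess_mat_def mult.commute)
qed

lemma hess_mat_symmetric:
  assumes "open S" "has_derivs_on k S f D" "x \<in> S" "2 \<le> k"
  shows "transpose (hess_mat (D 2) x) = hess_mat (D 2) x"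
  using second_derivative_symmetric[OF assms(1,2,4,3)]
  by (simp add: hess_mat_def transpose_def vec_eq_iff)

lemma has_derivs_on_continuous_on:
  assumes "has_derivs_on k S f D" "0 < k"
  shows "continuous_on S f"
proof -
  have "continuous_on S (\<lambda>y. D 0 y [])"
    using assms unfolding has_derivs_on_def
    by (intro has_derivative_continuous_on[where f'="\<lambda>x h. D (Suc 0) x [h]"]) auto
  then show ?thesis
    using assms by (simp add: has_derivs_on_def cong: continuous_on_cong)
qed

section \<open>Hellinger distance of normalised densities\<close>

text \<open>\<open>hellinger_dist\<close> fixes its reference measure by \<open>SOME\<close>; all
  that is known of it is that it is a probability measure dominating both arguments, and it need not
  be comparable with \<open>M\<close>. The sum of the two measures is dominated by \<open>M\<close>
  and by the chosen measure, and serves as a bridge: both integrals are rewritten as integrals over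
  it.\<close>

lemma hellinger_dist_density:
  fixes f g :: "'a \<Rightarrow> real"
  assumes [measurable]: "f \<in> borel_measurable M" "g \<in> borel_measurable M"
    and nn: "\<And>x. f x \<ge> 0" "\<And>x. g x \<ge> 0"
    and prob: "prob_space (density M f)" "prob_space (density M g)"
  shows "hellinger_dist (density M f) (density M g)
    = sqrt (enn2real (\<integral>\<^sup>+x. ennreal ((sqrt (f x) - sqrt (g x))\<^sup>2) \<partial>M))"
proof -
  let ?P = "\<lambda>\<rho>. prob_space \<rho> \<and> sets \<rho> = sets (density M f) \<and> sets (density M g) = sets (density M f) \<and>
      absolutely_continuous \<rho> (density M f) \<and> absolutely_continuous \<rho> (density M g)"
  have int1: "(\<integral>\<^sup>+x. ennreal (f x) \<partial>M) = 1" "(\<integral>\<^sup>+x. ennreal (g x) \<partial>M) = 1"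
    using prob_space.emeasure_space_1[OF prob(1)] prob_space.emeasure_space_1[OF prob(2)]
    by (simp_all add: emeasure_density cong: nn_integral_cong)
  \<comment> \<open>The average of the two measures shows that a dominating probability measure
    exists, so that the choice satisfies its specification.\<close>
  have "?P (density M (\<lambda>x. ennreal ((f x + g x) / 2)))"
  proof (intro conjI)
    have "(\<integral>\<^sup>+x. ennreal ((f x + g x) / 2) \<partial>M) = (\<integral>\<^sup>+x. ennreal (1/2) * (ennreal (f x) + ennreal (g x)) \<partial>M)"
    proof (rule nn_integral_cong)
      fix x
      have "ennreal (1/2) * (ennreal (f x) + ennreal (g x)) = ennreal (1/2 * (f x + g x))"
        using nn[of x] by (subst ennreal_mult) auto
      then show "ennreal ((f x + g x) / 2) = ennreal (1/2) * (ennreal (f x) + ennreal (g x))"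
        by simp
    qed
    also have "\<dots> = ennreal (1/2) * (1 + 1)"
      by (simp add: nn_integral_cmult nn_integral_add int1)
    also have "\<dots> = ennreal (1/2) * ennreal 2"
      by simp
    also have "\<dots> = 1"
      by (subst ennreal_mult[symmetric]) auto
    finally show "prob_space (density M (\<lambda>x. ennreal ((f x + g x) / 2)))"
      by (intro prob_spaceI) (simp add: emeasure_density cong: nn_integral_cong)
    have zero: "f x = 0 \<and> g x = 0" if "ennreal ((f x + g x) / 2) = 0" for x
    proof -
      have "(f x + g x) / 2 \<le> 0" using that by (simp add: ennreal_eq_0_iff)
      then have "f x + g x \<le> 0" by simp
      then have "f x + g x = 0" using nn[of x] by (intro antisym) auto
      then show ?thesis using add_nonneg_eq_0_iff[OF nn] by blast
    qed
    have ac: "absolutely_continuous (density M (\<lambda>x. ennreal ((f x + g x) / 2))) (density M k)"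
      if [measurable]: "k \<in> borel_measurable M" and k: "\<And>x. ennreal ((f x + g x) / 2) = 0 \<Longrightarrow> k x = 0"
      for k :: "'a \<Rightarrow> ennreal"
      unfolding absolutely_continuous_def
    proof
      fix A assume "A \<in> null_sets (density M (\<lambda>x. ennreal ((f x + g x) / 2)))"
      then have "A \<in> sets M" and AE: "AE x in M. x \<in> A \<longrightarrow> ennreal ((f x + g x) / 2) = 0"
        by (subst (asm) null_sets_density_iff; simp)+
      moreover have "AE x in M. x \<in> A \<longrightarrow> k x = 0"
        using AE by eventually_elim (use k in blast)
      ultimately show "A \<in> null_sets (density M k)"
        by (subst null_sets_density_iff) auto
    qed
    show "absolutely_continuous (density M (\<lambda>x. ennreal ((f x + g x) / 2))) (density M f)"
      by (rule ac) (simp, metis zero ennreal_0)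
    show "absolutely_continuous (density M (\<lambda>x. ennreal ((f x + g x) / 2))) (density M g)"
      by (rule ac) (simp, metis zero ennreal_0)
  qed auto
  note ex = this
  define \<rho> where \<rho>: "\<rho> = (SOME \<rho>. ?P \<rho>)"
  have P: "?P \<rho>" unfolding \<rho> by (rule someI[of ?P, OF ex])
  from P have prob_\<rho>: "prob_space \<rho>" by (elim conjE)
  from P have sets_\<rho>[measurable_cong]: "sets \<rho> = sets M" by simp
  from P have ac: "absolutely_continuous \<rho> (density M f)" by (elim conjE)
  from P have ac': "absolutely_continuous \<rho> (density M g)" by (elim conjE)
  interpret \<rho>: prob_space \<rho> by fact
  \<comment> \<open>\<open>s\<close> is the density of the sum with respect to \<open>M\<close>;
    \<open>u\<close> and \<open>v\<close> are the shares of the two measures in it. Where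
    \<open>f x + g x = 0\<close> both shares are \<open>0 / 0 = 0\<close>, consistent with
    \<open>f x = g x = 0\<close>.\<close>
  define s where "s x = ennreal (f x + g x)" for x
  define u where "u x = f x / (f x + g x)" for x
  define v where "v x = g x / (f x + g x)" for x
  have [measurable]: "s \<in> borel_measurable M" "u \<in> borel_measurable M" "v \<in> borel_measurable M"
    unfolding s_def u_def v_def by measurable
  have uv_nn: "u x \<ge> 0" "v x \<ge> 0" for x using nn by (auto simp: u_def v_def)
  have fu: "(f x + g x) * u x = f x" and gv: "(f x + g x) * v x = g x" for x
  proof -
    have "f x = 0 \<and> g x = 0" if "f x + g x = 0"
      using that add_nonneg_eq_0_iff[OF nn(1) nn(2), of x x] by blast
    then show "(f x + g x) * u x = f x" "(f x + g x) * v x = g x"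
      unfolding u_def v_def by (cases "f x + g x = 0"; simp)+
  qed
  have su: "s x * ennreal (u x) = ennreal (f x)" and sv: "s x * ennreal (v x) = ennreal (g x)" for x
    unfolding s_def using nn[of x] uv_nn[of x] by (simp_all add: ennreal_mult[symmetric] fu gv del: ennreal_plus)
  define \<tau> where "\<tau> = density M s"
  have sets_\<tau>: "sets \<tau> = sets \<rho>" by (simp add: \<tau>_def sets_\<rho>)
  have ac\<tau>: "absolutely_continuous \<rho> \<tau>"
    unfolding absolutely_continuous_def
  proof
    fix A assume "A \<in> null_sets \<rho>"
    then have "A \<in> null_sets (density M f)" "A \<in> null_sets (density M g)"
      using ac ac' by (auto simp: absolutely_continuous_def)
    then show "A \<in> null_sets \<tau>"
      unfolding \<tau>_def using nn by (auto simp: null_sets_density_iff s_def)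
  qed
  have "finite_measure \<tau>"
  proof
    have "emeasure \<tau> (space \<tau>) = (\<integral>\<^sup>+x. ennreal (f x) + ennreal (g x) \<partial>M)"
      unfolding \<tau>_def s_def using nn by (simp add: emeasure_density cong: nn_integral_cong)
    also have "\<dots> = 2" by (simp add: nn_integral_add int1)
    finally show "emeasure \<tau> (space \<tau>) \<noteq> \<infinity>" by simp
  qed
  then have sf: "sigma_finite_measure \<tau>"
    unfolding finite_measure_def by blast
  \<comment> \<open>\<open>c\<close> carries the sum over to \<open>\<rho>\<close>: the two
    densities with respect to \<open>\<rho>\<close> are \<open>c * u\<close> and
    \<open>c * v\<close> almost everywhere, and \<open>c\<close>, being finite almost everywhere,
    factors out of the squared difference of their roots.\<close>
  define c where "c = RN_deriv \<rho> \<tau>"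
  have [measurable]: "c \<in> borel_measurable M"
    unfolding c_def using borel_measurable_RN_deriv[of \<rho> \<tau>] measurable_cong_sets[OF sets_\<rho> refl] by blast
  have dens: "density \<rho> c = \<tau>"
    unfolding c_def using \<rho>.density_RN_deriv[OF ac\<tau> sets_\<tau>] .
  have c_fin: "AE x in \<rho>. c x \<noteq> \<infinity>"
    unfolding c_def using \<rho>.RN_deriv_finite[OF sf ac\<tau> sets_\<tau>] .
  have "density \<rho> (\<lambda>x. c x * ennreal (u x)) = density \<tau> u" "density \<rho> (\<lambda>x. c x * ennreal (v x)) = density \<tau> v"
    unfolding dens[symmetric] by (simp_all add: density_density_eq)
  moreover have "density \<tau> u = density M f" "density \<tau> v = density M g"
    unfolding \<tau>_def by (simp_all add: density_density_eq su sv)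
  ultimately have "AE x in \<rho>. c x * ennreal (u x) = RN_deriv \<rho> (density M f) x"
    and "AE x in \<rho>. c x * ennreal (v x) = RN_deriv \<rho> (density M g) x"
    by (auto intro!: \<rho>.RN_deriv_unique)
  then have "AE x in \<rho>. ennreal ((sqrt (enn2real (RN_deriv \<rho> (density M f) x))
        - sqrt (enn2real (RN_deriv \<rho> (density M g) x)))\<^sup>2) = c x * ennreal ((sqrt (u x) - sqrt (v x))\<^sup>2)"
    using c_fin
  proof eventually_elim
    case (elim x)
    then obtain r where r: "c x = ennreal r" "r \<ge> 0" by (cases "c x") auto
    have "(sqrt (r * u x) - sqrt (r * v x))\<^sup>2 = r * (sqrt (u x) - sqrt (v x))\<^sup>2"
      using r(2) by (simp add: real_sqrt_mult right_diff_distrib[symmetric] power_mult_distrib)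
    then show ?case
      unfolding elim(1,2)[symmetric] r(1) using r(2) uv_nn[of x]
      by (simp add: ennreal_mult[symmetric])
  qed
  then have "(\<integral>\<^sup>+x. ennreal ((sqrt (enn2real (RN_deriv \<rho> (density M f) x))
        - sqrt (enn2real (RN_deriv \<rho> (density M g) x)))\<^sup>2) \<partial>\<rho>)
      = (\<integral>\<^sup>+x. c x * ennreal ((sqrt (u x) - sqrt (v x))\<^sup>2) \<partial>\<rho>)"
    by (rule nn_integral_cong_AE)
  also have "\<dots> = (\<integral>\<^sup>+x. ennreal ((sqrt (u x) - sqrt (v x))\<^sup>2) \<partial>\<tau>)"
    unfolding dens[symmetric] by (subst nn_integral_density) auto
  also have "\<dots> = (\<integral>\<^sup>+x. s x * ennreal ((sqrt (u x) - sqrt (v x))\<^sup>2) \<partial>M)"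
    unfolding \<tau>_def by (subst nn_integral_density) auto
  also have "\<dots> = (\<integral>\<^sup>+x. ennreal ((sqrt (f x) - sqrt (g x))\<^sup>2) \<partial>M)"
  proof (rule nn_integral_cong)
    fix x
    have "(sqrt (f x) - sqrt (g x))\<^sup>2 = (sqrt ((f x + g x) * u x) - sqrt ((f x + g x) * v x))\<^sup>2"
      by (simp only: fu gv)
    also have "\<dots> = (f x + g x) * (sqrt (u x) - sqrt (v x))\<^sup>2"
      unfolding real_sqrt_mult right_diff_distrib[symmetric] power_mult_distrib using nn[of x] by simp
    finally show "s x * ennreal ((sqrt (u x) - sqrt (v x))\<^sup>2) = ennreal ((sqrt (f x) - sqrt (g x))\<^sup>2)"
      using nn[of x] by (simp add: s_def ennreal_mult[symmetric] del: ennreal_plus)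
  qed
  finally show ?thesis
    unfolding hellinger_dist_def Let_def \<rho>[symmetric] by simp
qed

text \<open>With the affinity \<open>c = \<integral> \<surd>(g h) / \<surd>(Z W)\<close>, the left side is \<open>2 - 2c\<close> and
  the integral on the right is \<open>Z + W - 2 c \<surd>(Z W)\<close>, whose minimum over \<open>Z\<close> is \<open>W (1 - c\<^sup>2)\<close>.\<close>

lemma normalized_sqrt_diff_le:
  fixes g h :: "'a \<Rightarrow> real"
  assumes int: "integrable M g" "integrable M h" and nn: "\<And>x. g x \<ge> 0" "\<And>x. h x \<ge> 0"
    and Z: "Z = (\<integral>x. g x \<partial>M)" "Z > 0" and W: "W = (\<integral>x. h x \<partial>M)" "W > 0"
  shows "integrable M (\<lambda>x. (sqrt (g x / Z) - sqrt (h x / W))\<^sup>2)"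
    and "integrable M (\<lambda>x. (sqrt (g x) - sqrt (h x))\<^sup>2)"
    and "(\<integral>x. (sqrt (g x / Z) - sqrt (h x / W))\<^sup>2 \<partial>M) \<le> 2 / W * (\<integral>x. (sqrt (g x) - sqrt (h x))\<^sup>2 \<partial>M)"
proof -
  have [measurable]: "g \<in> borel_measurable M" "h \<in> borel_measurable M"
    using int by auto
  have gh: "integrable M (\<lambda>x. sqrt (g x * h x))"
  proof (rule Bochner_Integration.integrable_bound)
    show "integrable M (\<lambda>x. g x + h x)" using int by auto
    show "AE x in M. norm (sqrt (g x * h x)) \<le> norm (g x + h x)"
    proof (rule AE_I2)
      fix x
      have "sqrt (g x * h x) \<le> (g x + h x) / 2"
        using nn by (intro arith_geo_mean_sqrt) auto
      then show "norm (sqrt (g x * h x)) \<le> norm (g x + h x)" using nn[of x] by simp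
    qed
  qed simp
  define C where "C = (\<integral>x. sqrt (g x * h x) \<partial>M)"
  define c where "c = C / sqrt (Z * W)"
  have sq: "sqrt (Z * W) > 0" using Z W by simp
  have e1: "(sqrt (g x / Z) - sqrt (h x / W))\<^sup>2 = g x / Z + h x / W - 2 / sqrt (Z * W) * sqrt (g x * h x)" for x
    using nn[of x] Z(2) W(2) by (simp add: power2_diff power_divide real_sqrt_divide real_sqrt_mult)
  have e2: "(sqrt (g x) - sqrt (h x))\<^sup>2 = g x + h x - 2 * sqrt (g x * h x)" for x
    using nn[of x] by (simp add: power2_diff real_sqrt_mult)
  show "integrable M (\<lambda>x. (sqrt (g x / Z) - sqrt (h x / W))\<^sup>2)"
    unfolding e1 using int gh by auto
  show "integrable M (\<lambda>x. (sqrt (g x) - sqrt (h x))\<^sup>2)"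
    unfolding e2 using int gh by auto
  have i1: "(\<integral>x. (sqrt (g x / Z) - sqrt (h x / W))\<^sup>2 \<partial>M) = 2 - 2 * c"
    unfolding e1 using int gh Z W by (simp add: c_def C_def)
  have i2: "(\<integral>x. (sqrt (g x) - sqrt (h x))\<^sup>2 \<partial>M) = Z + W - 2 * c * sqrt (Z * W)"
    unfolding e2 using int gh Z W sq by (simp add: c_def C_def)
  \<comment> \<open>\<open>c \<le> 1\<close> is the Cauchy-Schwarz inequality, read off from the
    nonnegativity of an integral already computed.\<close>
  have "0 \<le> 2 - 2 * c" unfolding i1[symmetric] by (intro Bochner_Integration.integral_nonneg) auto
  moreover have "0 \<le> c" unfolding c_def C_def using sq nn by (intro divide_nonneg_pos Bochner_Integration.integral_nonneg) auto
  ultimately have "c * c \<le> c" by (simp add: mult_left_le)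
  then have "W * (1 - c) \<le> W * (1 - c * c)" using W by simp
  \<comment> \<open>Completing the square in \<open>sqrt Z\<close>: what remains without the square
    no longer contains \<open>Z\<close>.\<close>
  also have "\<dots> \<le> W * (1 - c * c) + (sqrt Z - c * sqrt W)\<^sup>2" by simp
  also have "\<dots> = Z + W - 2 * c * sqrt (Z * W)"
    using Z W by (simp add: power2_diff power_mult_distrib real_sqrt_mult) (simp add: algebra_simps power2_eq_square)
  finally have "W * (1 - c) \<le> Z + W - 2 * c * sqrt (Z * W)" .
  then have "2 / W * (W * (1 - c)) \<le> 2 / W * (Z + W - 2 * c * sqrt (Z * W))"
    using W by (intro mult_left_mono) auto
  then show "(\<integral>x. (sqrt (g x / Z) - sqrt (h x / W))\<^sup>2 \<partial>M) \<le> 2 / W * (\<integral>x. (sqrt (g x) - sqrt (h x))\<^sup>2 \<partial>M)"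
    unfolding i1 i2 using W by (simp add: algebra_simps)
qed

lemma hellinger_dist_normalized_le:
  fixes g h :: "'a \<Rightarrow> real"
  assumes [measurable]: "g \<in> borel_measurable M" "h \<in> borel_measurable M"
    and nn: "\<And>x. g x \<ge> 0" "\<And>x. h x \<ge> 0"
    and Z: "(\<integral>\<^sup>+x. ennreal (g x) \<partial>M) = ennreal Z" "Z > 0"
    and W: "(\<integral>\<^sup>+x. ennreal (h x) \<partial>M) = ennreal W" "W > 0"
    and B: "(\<integral>\<^sup>+x. ennreal ((sqrt (g x) - sqrt (h x))\<^sup>2) \<partial>M) \<le> ennreal B" "B \<ge> 0"
  shows "hellinger_dist (density M (\<lambda>x. ennreal (g x / Z))) (density M (\<lambda>x. ennreal (h x / W))) \<le> sqrt (2 / W * B)"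
proof -
  have int: "integrable M g" "integrable M h"
    using nn Z W by (auto intro!: integrableI_nonneg)
  have Z': "Z = (\<integral>x. g x \<partial>M)" and W': "W = (\<integral>x. h x \<partial>M)"
    using nn_integral_eq_integral[OF int(1)] nn_integral_eq_integral[OF int(2)] nn Z W
    by (simp_all add: Bochner_Integration.integral_nonneg)
  have prob: "prob_space (density M (\<lambda>x. ennreal (k x / V)))"
    if [measurable]: "k \<in> borel_measurable M" and "\<And>x. k x \<ge> 0" and "(\<integral>\<^sup>+x. ennreal (k x) \<partial>M) = ennreal V" "V > 0"
    for k :: "'a \<Rightarrow> real" and V
  proof
    have "(\<integral>\<^sup>+x. ennreal (k x / V) \<partial>M) = (\<integral>\<^sup>+x. ennreal (k x) * ennreal (1 / V) \<partial>M)"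
      using that by (intro nn_integral_cong) (simp add: ennreal_mult[symmetric])
    also have "\<dots> = ennreal V * ennreal (1 / V)"
      using that by (subst nn_integral_multc) auto
    also have "\<dots> = 1"
      using that by (simp add: ennreal_mult[symmetric])
    finally show "emeasure (density M (\<lambda>x. ennreal (k x / V))) (space (density M (\<lambda>x. ennreal (k x / V)))) = 1"
      by (simp add: emeasure_density cong: nn_integral_cong)
  qed
  note * = normalized_sqrt_diff_le[OF int nn Z' Z(2) W' W(2)]
  have "hellinger_dist (density M (\<lambda>x. ennreal (g x / Z))) (density M (\<lambda>x. ennreal (h x / W)))
     = sqrt (enn2real (\<integral>\<^sup>+x. ennreal ((sqrt (g x / Z) - sqrt (h x / W))\<^sup>2) \<partial>M))"
    using nn Z W by (intro hellinger_dist_density prob) auto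
  also have "(\<integral>\<^sup>+x. ennreal ((sqrt (g x / Z) - sqrt (h x / W))\<^sup>2) \<partial>M) = ennreal (\<integral>x. (sqrt (g x / Z) - sqrt (h x / W))\<^sup>2 \<partial>M)"
    using *(1) by (intro nn_integral_eq_integral) auto
  also have "sqrt (enn2real \<dots>) \<le> sqrt (2 / W * B)"
  proof -
    have "ennreal (\<integral>x. (sqrt (g x) - sqrt (h x))\<^sup>2 \<partial>M) \<le> ennreal B"
      using B nn_integral_eq_integral[OF *(2)] by simp
    then have "(\<integral>x. (sqrt (g x) - sqrt (h x))\<^sup>2 \<partial>M) \<le> B"
      using B(2) by simp
    then have "2 / W * (\<integral>x. (sqrt (g x) - sqrt (h x))\<^sup>2 \<partial>M) \<le> 2 / W * B"
      using W(2) by (intro mult_left_mono) auto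
    then show ?thesis using *(3) by (simp add: Bochner_Integration.integral_nonneg)
  qed
  finally show ?thesis .
qed

section \<open>The Laplace approximation\<close>

lemma abs_exp_diff_le:
  fixes x y m :: real
  assumes "x \<le> m" "y \<le> m"
  shows "\<bar>exp x - exp y\<bar> \<le> exp m * \<bar>x - y\<bar>"
proof -
  have *: "exp b - exp a \<le> exp m * (b - a)" if "a \<le> b" "b \<le> m" for a b :: real
  proof -
    have eq: "exp b - exp a = exp b * (1 - exp (a - b))"
      by (simp add: exp_diff field_simps)
    have "1 - exp (a - b) \<le> b - a"
      using exp_ge_add_one_self[of "a - b"] by linarith
    then have "exp b - exp a \<le> exp b * (b - a)"
      unfolding eq
      by (intro mult_left_mono) auto
    also have "\<dots> \<le> exp m * (b - a)"
      using that by (intro mult_right_mono) auto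
    finally show ?thesis .
  qed
  show ?thesis
    using *[of x y] *[of y x] assms by (cases "x \<le> y") auto
qed

text \<open>The remainder consumes at most half of the quadratic term: \<open>Q / 2\<close> is at
  least \<open>c / 2 * N\<^sup>2\<close> and \<open>k * N ^ 3\<close> at most
  \<open>c / 4 * N\<^sup>2\<close>, so \<open>i \<ge> c / 4 * N\<^sup>2\<close>. The roots halve the
  exponents, the Lipschitz bound for \<open>exp\<close> produces \<open>n / 2 * (k * N ^ 3)\<close>,
  and squaring gives \<open>k\<^sup>2 / 4\<close> and restores the full decay.\<close>

lemma sqrt_exp_diff_near_le:
  fixes N Q i n k c :: real
  assumes n: "n \<ge> 0" and N: "N \<ge> 0" and k: "k \<ge> 0"
    and Taylor: "\<bar>i - Q / 2\<bar> \<le> k * N ^ 3" and Q: "Q \<ge> c * N\<^sup>2" and kN: "k * N \<le> c / 4"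
  shows "(sqrt (exp (- n * i)) - sqrt (exp (- (n / 2) * Q)))\<^sup>2 \<le> k\<^sup>2 / 4 * (n\<^sup>2 * N ^ 6 * exp (- n * (c / 4) * N\<^sup>2))"
proof -
  have sq: "sqrt (exp z) = exp (z / 2)" for z :: real
    by (rule real_sqrt_unique) (simp_all add: exp_double[symmetric])
  have "k * N * N\<^sup>2 \<le> c / 4 * N\<^sup>2"
    using kN by (intro mult_right_mono) auto
  then have cube: "k * N ^ 3 \<le> c / 4 * N\<^sup>2" by (simp add: power2_eq_square power3_eq_cube mult.assoc)
  have "0 \<le> k * N * N\<^sup>2" using k N by simp
  then have cN: "0 \<le> c / 4 * N\<^sup>2"
    using \<open>k * N * N\<^sup>2 \<le> c / 4 * N\<^sup>2\<close> by linarith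
  have i: "i \<ge> c / 4 * N\<^sup>2" using Taylor Q cube by (simp add: abs_le_iff)
  have Q2: "Q / 2 \<ge> c / 4 * N\<^sup>2" using Q cN by simp
  have m1: "- n * i / 2 \<le> - n * (c / 4 * N\<^sup>2) / 2"
    using mult_left_mono[OF i n] by (simp add: mult_ac)
  have m2: "- (n / 2) * Q / 2 \<le> - n * (c / 4 * N\<^sup>2) / 2"
    using mult_left_mono[OF Q2 n] by (simp add: mult_ac)
  have "\<bar>sqrt (exp (- n * i)) - sqrt (exp (- (n / 2) * Q))\<bar>
      \<le> exp (- n * (c / 4 * N\<^sup>2) / 2) * \<bar>- n * i / 2 - - (n / 2) * Q / 2\<bar>"
    unfolding sq by (rule abs_exp_diff_le[OF m1 m2])
  also have "- n * i / 2 - - (n / 2) * Q / 2 = - (n / 2) * (i - Q / 2)"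
    by (simp add: algebra_simps)
  also have "\<bar>- (n / 2) * (i - Q / 2)\<bar> = n / 2 * \<bar>i - Q / 2\<bar>"
    using n by (simp add: abs_mult)
  also have "exp (- n * (c / 4 * N\<^sup>2) / 2) * (n / 2 * \<bar>i - Q / 2\<bar>) \<le> exp (- n * (c / 4 * N\<^sup>2) / 2) * (n / 2 * (k * N ^ 3))"
    using n Taylor by (intro mult_left_mono) auto
  finally have "\<bar>sqrt (exp (- n * i)) - sqrt (exp (- (n / 2) * Q))\<bar> \<le> exp (- n * (c / 4 * N\<^sup>2) / 2) * (n / 2 * (k * N ^ 3))" .
  then have "(sqrt (exp (- n * i)) - sqrt (exp (- (n / 2) * Q)))\<^sup>2 \<le> (exp (- n * (c / 4 * N\<^sup>2) / 2) * (n / 2 * (k * N ^ 3)))\<^sup>2"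
    using power_mono[of "\<bar>sqrt (exp (- n * i)) - sqrt (exp (- (n / 2) * Q))\<bar>" _ 2] by simp
  also have "\<dots> = k\<^sup>2 / 4 * (n\<^sup>2 * N ^ 6 * (exp (- n * (c / 4 * N\<^sup>2) / 2))\<^sup>2)"
    by (simp add: power_mult_distrib power_divide power_mult[symmetric])
  also have "(exp (- n * (c / 4 * N\<^sup>2) / 2))\<^sup>2 = exp (- n * (c / 4) * N\<^sup>2)"
    by (simp add: exp_double[symmetric])
  finally show ?thesis .
qed

lemma sqrt_diff_square_le_add:
  fixes a b :: real
  assumes "a \<ge> 0" "b \<ge> 0"
  shows "(sqrt a - sqrt b)\<^sup>2 \<le> a + b"
  using assms by (simp add: power2_diff)

text \<open>Here \<open>n\<^sup>2 * N ^ 6 / r ^ 6\<close> is at least \<open>1\<close>. Inserting it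
  gives the Gaussian tail the shape of the near estimate, so that one integral serves both
  regions.\<close>

lemma exp_far_le:
  fixes N Q n c r :: real
  assumes n: "n \<ge> 1" and r: "0 < r" "r \<le> N" and c: "c \<ge> 0" and Q: "Q \<ge> c * N\<^sup>2"
  shows "exp (- (n / 2) * Q) \<le> 1 / r ^ 6 * (n\<^sup>2 * N ^ 6 * exp (- n * (c / 4) * N\<^sup>2))"
proof -
  have "c / 4 * N\<^sup>2 \<le> Q / 2" using Q c by (simp add: mult_nonneg_nonneg)
     (smt (verit) mult_nonneg_nonneg zero_le_power2)
  then have "n * (c / 4 * N\<^sup>2) \<le> n * (Q / 2)" using n by (intro mult_left_mono) auto
  then have e: "exp (- (n / 2) * Q) \<le> exp (- n * (c / 4) * N\<^sup>2)" by simp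
  have "1 * r ^ 6 \<le> n\<^sup>2 * N ^ 6"
    using n r by (intro mult_mono power_mono) auto
  then have "1 \<le> 1 / r ^ 6 * (n\<^sup>2 * N ^ 6)" using r by (simp add: field_simps)
  then have "1 * exp (- n * (c / 4) * N\<^sup>2) \<le> 1 / r ^ 6 * (n\<^sup>2 * N ^ 6) * exp (- n * (c / 4) * N\<^sup>2)"
    by (intro mult_right_mono) auto
  with e show ?thesis by (simp only: mult_1 mult.assoc)
qed

lemma abs_quadratic_form_le:
  fixes A :: "real^'n^'n"
  shows "\<bar>v \<bullet> (A *v v)\<bar> \<le> (\<Sum>i\<in>UNIV. \<Sum>j\<in>UNIV. \<bar>A $ i $ j\<bar>) * (norm v)\<^sup>2"
proof -
  have "v \<bullet> (A *v v) = (\<Sum>i\<in>UNIV. \<Sum>j\<in>UNIV. v $ i * (A $ i $ j * v $ j))"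
    by (simp add: inner_vec_def matrix_vector_mult_def sum_distrib_left)
  also have "\<bar>\<dots>\<bar> \<le> (\<Sum>i\<in>UNIV. \<bar>\<Sum>j\<in>UNIV. v $ i * (A $ i $ j * v $ j)\<bar>)"
    by (rule sum_abs)
  also have "\<dots> \<le> (\<Sum>i\<in>UNIV. \<Sum>j\<in>UNIV. \<bar>v $ i * (A $ i $ j * v $ j)\<bar>)"
    by (intro sum_mono sum_abs)
  also have "\<dots> \<le> (\<Sum>i\<in>UNIV. \<Sum>j\<in>UNIV. \<bar>A $ i $ j\<bar> * (norm v)\<^sup>2)"
  proof (intro sum_mono)
    fix i j
    have "\<bar>v $ i\<bar> * \<bar>v $ j\<bar> \<le> norm v * norm v"
      by (intro mult_mono component_le_norm_cart) auto
    then have "\<bar>A $ i $ j\<bar> * (\<bar>v $ i\<bar> * \<bar>v $ j\<bar>) \<le> \<bar>A $ i $ j\<bar> * (norm v)\<^sup>2"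
      by (intro mult_left_mono) (auto simp: power2_eq_square)
    then show "\<bar>v $ i * (A $ i $ j * v $ j)\<bar> \<le> \<bar>A $ i $ j\<bar> * (norm v)\<^sup>2"
      by (simp add: abs_mult mult_ac)
  qed
  finally show ?thesis by (simp add: sum_distrib_right)
qed

text \<open>The minimum over the compact unit sphere is positive, and the form is homogeneous of
  degree two.\<close>

lemma posdef_coercive:
  fixes M :: "real^'n^'n"
  assumes "posdef M"
  obtains c where "c > 0" "\<And>v. v \<bullet> (M *v v) \<ge> c * (norm v)\<^sup>2"
proof -
  have cont: "continuous_on (sphere 0 1) (\<lambda>v. v \<bullet> (M *v v))"
    by (intro continuous_intros linear_continuous_on matrix_vector_mul_bounded_linear)
  obtain u :: "real^'n" where u: "u \<in> sphere 0 1" "\<And>v. v \<in> sphere 0 1 \<Longrightarrow> u \<bullet> (M *v u) \<le> v \<bullet> (M *v v)"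
    using continuous_attains_inf[OF compact_sphere _ cont] by fastforce
  have "u \<noteq> 0" using u(1) by auto
  then have pos: "u \<bullet> (M *v u) > 0" using assms by (simp add: posdef_def)
  have "v \<bullet> (M *v v) \<ge> u \<bullet> (M *v u) * (norm v)\<^sup>2" for v
  proof (cases "v = 0")
    case False
    define w where "w = v /\<^sub>R norm v"
    have v: "v = norm v *\<^sub>R w" using False by (simp add: w_def)
    have "w \<in> sphere 0 1" using False by (simp add: w_def)
    then have "u \<bullet> (M *v u) * (norm v)\<^sup>2 \<le> w \<bullet> (M *v w) * (norm v)\<^sup>2"
      using u(2) by (intro mult_right_mono) auto
    also have "\<dots> = (norm v *\<^sub>R w) \<bullet> (M *v (norm v *\<^sub>R w))"
      by (simp add: linear_scale[OF matrix_vector_mul_linear] power2_eq_square)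
    finally show ?thesis by (simp only: v[symmetric])
  qed simp
  then show ?thesis using that pos by blast
qed

text \<open>Half of the coercivity constant of the limit is given up to the perturbation
  \<open>Hn n - H\<close>. A single constant for all large \<open>n\<close> makes the decay rate in
  the later integrals uniform.\<close>

lemma eventually_uniformly_coercive:
  fixes Hn :: "nat \<Rightarrow> real^'n^'n"
  assumes lim: "Hn \<longlonglongrightarrow> H" and pd: "posdef H"
  obtains c where "c > 0" "\<forall>\<^sub>F n in sequentially. \<forall>v. v \<bullet> (Hn n *v v) \<ge> c * (norm v)\<^sup>2"
proof -
  obtain c where c: "c > 0" "\<And>v. v \<bullet> (H *v v) \<ge> c * (norm v)\<^sup>2"
    using posdef_coercive[OF pd] by blast
  have "(\<lambda>n. \<Sum>i\<in>UNIV. \<Sum>j\<in>UNIV. \<bar>(Hn n - H) $ i $ j\<bar>) \<longlonglongrightarrow> (\<Sum>i\<in>UNIV. \<Sum>j\<in>UNIV. \<bar>(H - H) $ i $ j\<bar>)"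
    by (intro tendsto_sum tendsto_rabs tendsto_vec_nth tendsto_diff lim tendsto_const)
  then have "\<forall>\<^sub>F n in sequentially. (\<Sum>i\<in>UNIV. \<Sum>j\<in>UNIV. \<bar>(Hn n - H) $ i $ j\<bar>) < c / 2"
    using c(1) by (intro order_tendstoD(2)) auto
  then have "\<forall>\<^sub>F n in sequentially. \<forall>v. v \<bullet> (Hn n *v v) \<ge> c / 2 * (norm v)\<^sup>2"
  proof eventually_elim
    case (elim n)
    show ?case
    proof
      fix v
      have "\<bar>v \<bullet> ((Hn n - H) *v v)\<bar> \<le> (\<Sum>i\<in>UNIV. \<Sum>j\<in>UNIV. \<bar>(Hn n - H) $ i $ j\<bar>) * (norm v)\<^sup>2"
        by (rule abs_quadratic_form_le)
      also have "\<dots> \<le> c / 2 * (norm v)\<^sup>2"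
        using elim by (intro mult_right_mono) auto
      finally have "- (c / 2 * (norm v)\<^sup>2) \<le> v \<bullet> ((Hn n - H) *v v)" by linarith
      moreover have "v \<bullet> (Hn n *v v) = v \<bullet> (H *v v) + v \<bullet> ((Hn n - H) *v v)"
        by (simp add: matrix_vector_mult_diff_rdistrib inner_diff_right)
      ultimately show "v \<bullet> (Hn n *v v) \<ge> c / 2 * (norm v)\<^sup>2"
        using c(2)[of v] by linarith
    qed
  qed
  then show ?thesis using that[of "c / 2"] c(1) by simp
qed

lemma tendsto_det:
  fixes Hn :: "nat \<Rightarrow> real^'n^'n"
  assumes "Hn \<longlonglongrightarrow> H"
  shows "(\<lambda>n. det (Hn n)) \<longlonglongrightarrow> det H"
  unfolding det_def
  by (intro tendsto_sum tendsto_mult tendsto_prod tendsto_vec_nth tendsto_const assms)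

text \<open>This is the part of the argument that does not see the prior or the potential. With
  dimension \<open>d\<close>, the first error term integrates to order
  \<open>n powr (- 1 - d / 2)\<close>, the exponentially small one is absorbed into it, and division
  by \<open>W n\<close> leaves order \<open>1 / n\<close> under the root.\<close>

lemma hellinger_dist_gaussian_rate:
  fixes g :: "nat \<Rightarrow> real^'n \<Rightarrow> real" and m :: "nat \<Rightarrow> real^'n" and Hn :: "nat \<Rightarrow> real^'n^'n"
  assumes meas: "\<And>n. n \<ge> 1 \<Longrightarrow> g n \<in> borel_measurable borel" and nn: "\<And>n x. g n x \<ge> 0"
    and Z: "\<And>n. n \<ge> 1 \<Longrightarrow> (\<integral>\<^sup>+x. ennreal (g n x) \<partial>lborel) = ennreal (Z n)" "\<And>n. n \<ge> 1 \<Longrightarrow> Z n > 0"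
    and pd: "\<forall>\<^sub>F n in sequentially. posdef (Hn n) \<and> transpose (Hn n) = Hn n"
    and lim: "Hn \<longlonglongrightarrow> H" "det H > 0"
    and q: "integrable lborel q" "\<And>x. q x \<ge> 0"
    and pos: "A \<ge> 0" "b > 0" "\<eta> > 0"
    and bound: "\<forall>\<^sub>F n in sequentially. \<forall>x.
      (sqrt (g n x) - sqrt (exp (- (real n / 2) * ((x - m n) \<bullet> (Hn n *v (x - m n))))))\<^sup>2
      \<le> A * ((real n)\<^sup>2 * norm (x - m n) ^ 6 * exp (- real n * b * (norm (x - m n))\<^sup>2)) + exp (- \<eta> * real n) * q x"
  shows "(\<lambda>n. hellinger_dist (density lborel (\<lambda>x. ennreal (g n x / Z n)))
      (gaussian (m n) ((1 / real n) *\<^sub>R matrix_inv (Hn n)))) \<in> O(\<lambda>n. real n powr (-1/2))"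
proof -
  let ?d = "real CARD('n)"
  have q_meas[measurable]: "q \<in> borel_measurable borel"
    using borel_measurable_integrable[OF q(1)] by simp
  define M where "M = enn2real (\<integral>\<^sup>+x. ennreal (norm x ^ 6 * exp (- b * (norm x)\<^sup>2)) \<partial>(lborel :: (real^'n) measure))"
  have M: "(\<integral>\<^sup>+x. ennreal (norm x ^ 6 * exp (- b * (norm x)\<^sup>2)) \<partial>(lborel :: (real^'n) measure)) = ennreal M" "M \<ge> 0"
    using nn_integral_norm6_gaussian_finite[OF \<open>b > 0\<close>, where 'n='n] by (simp_all add: M_def)
  define J where "J = (\<integral>x. q x \<partial>lborel)"
  have J: "(\<integral>\<^sup>+x. ennreal (q x) \<partial>lborel) = ennreal J" "J \<ge> 0"
    unfolding J_def using q by (auto intro!: nn_integral_eq_integral Bochner_Integration.integral_nonneg)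
  define W where "W n = (2 * pi) powr (?d / 2) * real n powr (- ?d / 2) / sqrt (det (Hn n))" for n
  \<comment> \<open>Once \<open>det (Hn n) < 2 * det H\<close>, the number
    \<open>w * real n powr (- ?d / 2)\<close> is a lower bound for \<open>W n\<close>; the factor 2
    is an arbitrary margin above the limit.\<close>
  define w where "w = (2 * pi) powr (?d / 2) / sqrt (2 * det H)"
  have w: "w > 0" using lim by (simp add: w_def)
  define B where "B n = A * (real n powr (- 1 - ?d / 2) * M) + exp (- \<eta> * real n) * J" for n
  have B_nn: "B n \<ge> 0" for n unfolding B_def using pos M J by simp
  have "\<forall>\<^sub>F n in sequentially. det (Hn n) < 2 * det H"
    using lim by (intro order_tendstoD(2)[OF tendsto_det]) auto
  \<comment> \<open>Decay against exactly this power lets the exponential factor be replaced by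
    \<open>real n powr (- 1 - ?d / 2)\<close>.\<close>
  moreover have "(\<lambda>n::nat. exp (- \<eta> * real n) * real n powr (1 + ?d / 2)) \<longlonglongrightarrow> 0"
    using \<open>\<eta> > 0\<close> by real_asymp
  then have "\<forall>\<^sub>F n in sequentially. exp (- \<eta> * real n) * real n powr (1 + ?d / 2) < 1"
    by (rule order_tendstoD) simp
  ultimately have main: "\<forall>\<^sub>F n in sequentially. hellinger_dist (density lborel (\<lambda>x. ennreal (g n x / Z n)))
      (gaussian (m n) ((1 / real n) *\<^sub>R matrix_inv (Hn n))) \<le> sqrt (2 / w * (A * M + J)) * real n powr (-1/2)"
    using pd bound eventually_ge_at_top[of 1]
  proof eventually_elim
    case (elim n)
    define h where "h x = exp (- (real n / 2) * ((x - m n) \<bullet> (Hn n *v (x - m n))))" for x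
    have n: "real n > 0" and n1: "n \<ge> 1" using elim by auto
    note [measurable] = meas[OF n1]
    have Hpd: "posdef (Hn n)" "transpose (Hn n) = Hn n" using elim by auto
    have dH: "det (Hn n) > 0" using posdef_det_pos[OF Hpd] .
    have h_nn: "h x \<ge> 0" for x by (simp add: h_def)
    have W0: "W n > 0" using dH n by (simp add: W_def)
    note gp = gaussian_precision[OF Hpd n, of "m n", folded W_def h_def]
    have [measurable]: "h \<in> borel_measurable borel"
      unfolding h_def by (intro borel_measurable_continuous_onI continuous_intros
        linear_continuous_on_compose[OF _ matrix_vector_mul_linear])
    have "(\<integral>\<^sup>+x. ennreal ((sqrt (g n x) - sqrt (h x))\<^sup>2) \<partial>lborel)
        \<le> (\<integral>\<^sup>+x. ennreal A * ennreal ((real n)\<^sup>2 * norm (x - m n) ^ 6 * exp (- real n * b * (norm (x - m n))\<^sup>2))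
              + ennreal (exp (- \<eta> * real n)) * ennreal (q x) \<partial>lborel)"
    proof (rule nn_integral_mono)
      fix x
      have "ennreal ((sqrt (g n x) - sqrt (h x))\<^sup>2)
          \<le> ennreal (A * ((real n)\<^sup>2 * norm (x - m n) ^ 6 * exp (- real n * b * (norm (x - m n))\<^sup>2)) + exp (- \<eta> * real n) * q x)"
        using elim by (intro ennreal_leI) (simp add: h_def)
      also have "\<dots> = ennreal A * ennreal ((real n)\<^sup>2 * norm (x - m n) ^ 6 * exp (- real n * b * (norm (x - m n))\<^sup>2))
              + ennreal (exp (- \<eta> * real n)) * ennreal (q x)"
        using pos q by (subst ennreal_plus) (auto simp: ennreal_mult)
      finally show "ennreal ((sqrt (g n x) - sqrt (h x))\<^sup>2) \<le>
          ennreal A * ennreal ((real n)\<^sup>2 * norm (x - m n) ^ 6 * exp (- real n * b * (norm (x - m n))\<^sup>2))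
              + ennreal (exp (- \<eta> * real n)) * ennreal (q x)" .
    qed
    also have "\<dots> = ennreal A * (\<integral>\<^sup>+x. ennreal ((real n)\<^sup>2 * norm (x - m n) ^ 6 * exp (- real n * b * (norm (x - m n))\<^sup>2)) \<partial>lborel)
        + ennreal (exp (- \<eta> * real n)) * (\<integral>\<^sup>+x. ennreal (q x) \<partial>lborel)"
      by (subst nn_integral_add) (simp_all add: nn_integral_cmult)
    also have "\<dots> = ennreal A * (ennreal (real n powr (- 1 - ?d / 2)) * ennreal M) + ennreal (exp (- \<eta> * real n)) * ennreal J"
      unfolding nn_integral_norm6_gaussian_scale[OF n] M J ..
    also have "\<dots> = ennreal (B n)"
      unfolding B_def using pos M J by (subst ennreal_plus) (auto simp: ennreal_mult)
    finally have "hellinger_dist (density lborel (\<lambda>x. ennreal (g n x / Z n))) (density lborel (\<lambda>x. ennreal (h x / W n)))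
        \<le> sqrt (2 / W n * B n)"
      using nn h_nn Z n1 gp(2) W0 B_nn by (intro hellinger_dist_normalized_le) auto
    also have "\<dots> \<le> sqrt (2 / w * (A * M + J) * real n powr (- 1))"
    proof (rule real_sqrt_le_mono)
      have "w * real n powr (- ?d / 2) \<le> W n"
      proof -
        have "sqrt (det (Hn n)) \<le> sqrt (2 * det H)" using elim by (intro real_sqrt_le_mono) auto
        then have "(2 * pi) powr (?d / 2) * real n powr (- ?d / 2) / sqrt (2 * det H) \<le> W n"
          unfolding W_def using dH by (intro divide_left_mono) (auto simp: lim)
        then show ?thesis by (simp add: w_def)
      qed
      then have "2 / W n \<le> 2 / (w * real n powr (- ?d / 2))"
        using w n by (intro divide_left_mono) (auto simp: W0)
      also have "\<dots> = 2 / w * real n powr (?d / 2)"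
        using n by (simp add: powr_minus field_simps)
      finally have "2 / W n * B n \<le> 2 / w * real n powr (?d / 2) * B n"
        using B_nn by (intro mult_right_mono)
      also have "\<dots> \<le> 2 / w * real n powr (?d / 2) * ((A * M + J) * real n powr (- 1 - ?d / 2))"
      proof (intro mult_left_mono)
        have "exp (- \<eta> * real n) = exp (- \<eta> * real n) * real n powr (1 + ?d / 2) * real n powr (- 1 - ?d / 2)"
          using n by (simp add: mult.assoc powr_add[symmetric])
        also have "\<dots> \<le> 1 * real n powr (- 1 - ?d / 2)"
          using elim by (intro mult_right_mono) auto
        finally have "exp (- \<eta> * real n) * J \<le> real n powr (- 1 - ?d / 2) * J"
          using J(2) by (intro mult_right_mono) auto
        then show "B n \<le> (A * M + J) * real n powr (- 1 - ?d / 2)"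
          by (simp add: B_def algebra_simps)
      qed (use w in auto)
      also have "\<dots> = 2 / w * (A * M + J) * (real n powr (?d / 2) * real n powr (- 1 - ?d / 2))"
        by simp
      also have "real n powr (?d / 2) * real n powr (- 1 - ?d / 2) = real n powr (- 1)"
        unfolding powr_add[symmetric] by simp
      finally show "2 / W n * B n \<le> 2 / w * (A * M + J) * real n powr (- 1)" .
    qed
    also have "\<dots> = sqrt (2 / w * (A * M + J)) * real n powr (-1/2)"
    proof -
      have "sqrt (real n powr (- 1)) = (real n powr (- 1)) powr (1/2)"
        by (rule powr_half_sqrt[symmetric]) (rule powr_ge_zero)
      also have "\<dots> = real n powr (-1/2)" unfolding powr_powr by simp
      finally show ?thesis unfolding real_sqrt_mult[of "2 / w * (A * M + J)"] by (simp only:)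
    qed
    finally show ?case unfolding gp(1) .
  qed
  have nonneg: "hellinger_dist \<mu> \<nu> \<ge> 0" for \<mu> \<nu> :: "(real^'n) measure"
    by (simp add: hellinger_dist_def Let_def)
  show ?thesis
  proof (rule bigoI)
    show "\<forall>\<^sub>F n in sequentially. norm (hellinger_dist (density lborel (\<lambda>x. ennreal (g n x / Z n)))
      (gaussian (m n) ((1 / real n) *\<^sub>R matrix_inv (Hn n)))) \<le> sqrt (2 / w * (A * M + J)) * norm (real n powr (-1/2))"
      using main by eventually_elim (simp add: nonneg)
  qed
qed

theorem theorem2:
  fixes \<pi>0 :: "real^'n \<Rightarrow> real"
    and \<mu>0 :: "(real^'n) measure"
    and S0 :: "(real^'n) set"
    and \<Phi> :: "nat \<Rightarrow> real^'n \<Rightarrow> real"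
    and I :: "nat \<Rightarrow> real^'n \<Rightarrow> real"
    and Z :: "nat \<Rightarrow> ennreal"
    and \<mu> :: "nat \<Rightarrow> (real^'n) measure"
    and L :: "nat \<Rightarrow> (real^'n) measure"
    and D\<Phi> :: "nat \<Rightarrow> nat \<Rightarrow> real^'n \<Rightarrow> (real^'n) list \<Rightarrow> real"
    and D\<pi> :: "nat \<Rightarrow> real^'n \<Rightarrow> (real^'n) list \<Rightarrow> real"
    and DI :: "nat \<Rightarrow> nat \<Rightarrow> real^'n \<Rightarrow> (real^'n) list \<Rightarrow> real"
    and Dlog :: "nat \<Rightarrow> real^'n \<Rightarrow> (real^'n) list \<Rightarrow> real"
    and xn :: "nat \<Rightarrow> real^'n"
    and xstar :: "real^'n"
    and H :: "real^'n^'n"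
  assumes \<pi>0_meas: "\<pi>0 \<in> borel_measurable lborel"
    and \<pi>0_nonneg: "\<And>x. \<pi>0 x \<ge> 0"
    and \<mu>0_def: "\<mu>0 = density lborel (\<lambda>x. ennreal (\<pi>0 x))"
    and \<mu>0_prob: "prob_space \<mu>0"
    and S0_def: "S0 = {x. \<pi>0 x > 0}"
    and Z_def: "\<And>n. Z n = (\<integral>\<^sup>+x\<in>S0. ennreal (exp (- real n * \<Phi> n x)) \<partial>\<mu>0)"
    and Z_pos: "\<And>n. n \<ge> 1 \<Longrightarrow> 0 < Z n \<and> Z n < \<infinity>"
    and \<mu>_def: "\<And>n. \<mu> n = density \<mu>0 (\<lambda>x. ennreal (indicator S0 x * exp (- real n * \<Phi> n x) / enn2real (Z n)))"
    and I_def: "\<And>n x. I n x = \<Phi> n x - (1 / real n) * ln (\<pi>0 x)"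
    \<comment> \<open>smoothness (A1)/(A2): C^3 on S0 with the given derivatives\<close>
    and \<Phi>_C3: "\<And>n. n \<ge> 1 \<Longrightarrow> has_derivs_on 3 S0 (\<Phi> n) (D\<Phi> n)"
    and \<pi>0_C3: "has_derivs_on 3 S0 \<pi>0 D\<pi>"
    and I_derivs: "\<And>n. n \<ge> 1 \<Longrightarrow> has_derivs_on 3 S0 (I n) (DI n)"
    and log_derivs: "has_derivs_on 3 S0 (\<lambda>x. ln (\<pi>0 x)) Dlog"
    \<comment> \<open>(A1)\<close>
    and xn_in: "\<And>n. n \<ge> 1 \<Longrightarrow> xn n \<in> S0"
    and xn_unique_min: "\<And>n y. n \<ge> 1 \<Longrightarrow> y \<in> S0 \<Longrightarrow> y \<noteq> xn n \<Longrightarrow> I n (xn n) < I n y"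
    and I_xn_zero: "\<And>n. n \<ge> 1 \<Longrightarrow> I n (xn n) = 0"
    and grad_I_xn: "\<And>n h. n \<ge> 1 \<Longrightarrow> DI n 1 (xn n) [h] = 0"
    and hess_I_posdef: "\<And>n. n \<ge> 1 \<Longrightarrow> posdef (hess_mat (DI n 2) (xn n))"
    \<comment> \<open>(A2)(i)\<close>
    and xn_lim: "xn \<longlonglongrightarrow> xstar"
    and H_lim: "(\<lambda>n. hess_mat (D\<Phi> n 2) (xn n)) \<longlonglongrightarrow> H"
    and H_posdef: "posdef H"
    and xstar_int: "xstar \<in> interior S0"
    \<comment> \<open>(A2)(ii)\<close>
    and A2ii: "\<And>r. r > 0 \<Longrightarrow> \<exists>nr \<delta> K. \<delta> > 0 \<and> (\<forall>n\<ge>nr.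
                 (\<forall>x\<in>S0. norm (x - xn n) > r \<longrightarrow> I n x \<ge> \<delta>) \<and>
                 (\<forall>x\<in>S0. norm x \<le> r \<longrightarrow> opnorm3 (Dlog 3 x) \<le> K) \<and>
                 (\<forall>x\<in>S0. norm x \<le> r \<longrightarrow> opnorm3 (D\<Phi> n 3 x) \<le> K))"
    \<comment> \<open>(A2)(iii)\<close>
    and A2iii: "\<exists>n0 \<epsilon> q. 0 < \<epsilon> \<and> \<epsilon> < 1 \<and> (\<forall>x\<in>S0. q x \<ge> 0) \<and>
                 (\<forall>n\<ge>n0. \<forall>x\<in>S0. exp (- real n * I n x) \<le> q x) \<and>
                 set_integrable lborel S0 (\<lambda>x. q x powr (1 - \<epsilon>))"
    \<comment> \<open>Laplace approximation N(x_n, n^{-1} C_n), C_n^{-1} = Hessian of I_n at x_n\<close>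
    and L_def: "\<And>n. L n = gaussian (xn n) ((1 / real n) *\<^sub>R matrix_inv (hess_mat (DI n 2) (xn n)))"
  shows "(\<lambda>n. hellinger_dist (\<mu> n) (L n)) \<in> O(\<lambda>n. real n powr (-1/2))"
proof -

  \<comment> \<open>Localisation to a ball around \<open>xstar\<close> and the limit of the
    Hessians\<close>
  obtain e where e: "e > 0" "ball xstar e \<subseteq> S0"
    using xstar_int by (auto simp: mem_interior)
  \<comment> \<open>Half of the available radius: once \<open>xn n\<close> is within
    \<open>R\<close> of \<open>xstar\<close>, every segment of length at most \<open>R\<close>
    starting at \<open>xn n\<close> stays in \<open>U\<close>.\<close>
  define R where "R = e / 2"
  define U where "U = ball xstar (2 * R)"
  have R: "R > 0" and US: "U \<subseteq> S0" using e by (auto simp: R_def U_def)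
  have oU: "open U" by (simp add: U_def)
  have IU: "has_derivs_on 3 U (I n) (DI n)" if "n \<ge> 1" for n
    using has_derivs_on_subset[OF I_derivs[OF that] US] .
  have \<Phi>U: "has_derivs_on 3 U (\<Phi> n) (D\<Phi> n)" if "n \<ge> 1" for n
    using has_derivs_on_subset[OF \<Phi>_C3[OF that] US] .
  note logU = has_derivs_on_subset[OF log_derivs US]
  \<comment> \<open>\<open>DI\<close>, \<open>D\<Phi>\<close> and \<open>Dlog\<close> are separate
    data; on the open set \<open>U\<close> uniqueness forces the relation suggested by
    \<open>I_def\<close>. Through it the bounds on third derivatives reach
    \<open>I n\<close>.\<close>
  have DI_eq: "DI n j x hs = D\<Phi> n j x hs - 1 / real n * Dlog j x hs"
    if "n \<ge> 1" "x \<in> U" "length hs = j" "j \<le> 3" for n j x hs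
  proof -
    have "I n = (\<lambda>x. \<Phi> n x - 1 / real n * ln (\<pi>0 x))" by (rule ext) (rule I_def)
    then have "has_derivs_on 3 U (I n) (\<lambda>j x hs. D\<Phi> n j x hs - 1 / real n * Dlog j x hs)"
      using has_derivs_on_diff_scaled[OF \<Phi>U[OF that(1)] logU, of "1 / real n"] by (simp only:)
    from has_derivs_on_unique[OF oU IU[OF that(1)] this that(4,2,3)] show ?thesis .
  qed
  have near_star: "\<forall>\<^sub>F n in sequentially. dist (xn n) xstar < R"
    using tendstoD[OF xn_lim R] .
  have inU: "\<forall>\<^sub>F n in sequentially. n \<ge> 1 \<and> xn n \<in> U"
    using near_star eventually_ge_at_top[of 1]
    by eventually_elim (use R in \<open>auto simp: U_def dist_commute\<close>)
  define Hn where "Hn n = hess_mat (DI n 2) (xn n)" for n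
  have Hn_sym: "\<forall>\<^sub>F n in sequentially. transpose (Hn n) = Hn n"
    using inU by eventually_elim (auto simp: Hn_def intro!: hess_mat_symmetric[OF oU IU])
  have Hn_pd: "\<forall>\<^sub>F n in sequentially. posdef (Hn n) \<and> transpose (Hn n) = Hn n"
    using Hn_sym eventually_ge_at_top[of 1]
    by eventually_elim (auto simp: Hn_def intro!: hess_I_posdef)
  \<comment> \<open>\<open>H\<close> is the limit of the Hessians of \<open>\<Phi> n\<close>, while
    the Gaussian uses those of \<open>I n\<close>. They differ by \<open>1 / real n\<close> times
    the Hessian of the logarithm of \<open>\<pi>0\<close> at \<open>xn n\<close>, which converges by
    continuity at \<open>xstar\<close>, so the difference vanishes.\<close>
  have Hn_lim: "Hn \<longlonglongrightarrow> H"
  proof -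
    have "isCont (\<lambda>y. Dlog 2 y [h, h']) xstar" for h h'
      using R by (intro has_derivs_on_isCont[OF logU oU]) (auto simp: U_def)
    then have "(\<lambda>n. Dlog 2 (xn n) [h, h']) \<longlonglongrightarrow> Dlog 2 xstar [h, h']" for h h'
      using isCont_tendsto_compose xn_lim by blast
    then have "(\<lambda>n. hess_mat (Dlog 2) (xn n)) \<longlonglongrightarrow> hess_mat (Dlog 2) xstar"
      unfolding hess_mat_def by (intro tendsto_vec_lambda)
    moreover have "(\<lambda>n. 1 / real n) \<longlonglongrightarrow> 0" by (rule lim_1_over_n)
    ultimately have "(\<lambda>n. hess_mat (D\<Phi> n 2) (xn n) - (1 / real n) *\<^sub>R hess_mat (Dlog 2) (xn n))
        \<longlonglongrightarrow> H - 0 *\<^sub>R hess_mat (Dlog 2) xstar"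
      by (intro tendsto_diff tendsto_scaleR H_lim)
    moreover have "\<forall>\<^sub>F n in sequentially.
        hess_mat (D\<Phi> n 2) (xn n) - (1 / real n) *\<^sub>R hess_mat (Dlog 2) (xn n) = Hn n"
      using inU by eventually_elim (auto simp: Hn_def hess_mat_def vec_eq_iff DI_eq)
    ultimately show ?thesis by (simp add: tendsto_cong)
  qed
  \<comment> \<open>\<open>posdef\<close> speaks of the quadratic form alone; the symmetry used for
    \<open>det H > 0\<close> is inherited from the Hessians \<open>Hn n\<close>.\<close>
  have "transpose H = H"
  proof -
    have "H $ j $ i = H $ i $ j" for i j
    proof (rule LIMSEQ_unique)
      show "(\<lambda>n. Hn n $ j $ i) \<longlonglongrightarrow> H $ j $ i" by (intro tendsto_vec_nth Hn_lim)
      have "\<forall>\<^sub>F n in sequentially. Hn n $ i $ j = Hn n $ j $ i"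
        using Hn_sym by eventually_elim (simp add: transpose_def vec_eq_iff)
      moreover have "(\<lambda>n. Hn n $ i $ j) \<longlonglongrightarrow> H $ i $ j" by (intro tendsto_vec_nth Hn_lim)
      ultimately show "(\<lambda>n. Hn n $ j $ i) \<longlonglongrightarrow> H $ i $ j" by (rule Lim_transform_eventually[rotated])
    qed
    then show ?thesis by (simp add: transpose_def vec_eq_iff)
  qed
  then have dH: "det H > 0" using posdef_det_pos[OF H_posdef] by simp

  \<comment> \<open>Choice of constants and radii\<close>
  obtain c where c: "c > 0" and coer: "\<forall>\<^sub>F n in sequentially. \<forall>v. v \<bullet> (Hn n *v v) \<ge> c * (norm v)\<^sup>2"
    using eventually_uniformly_coercive[OF Hn_lim H_posdef] by blast
  \<comment> \<open>Third derivatives are bounded on balls around the origin; the one of radius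
    \<open>r'\<close> contains \<open>U\<close>.\<close>
  define r' where "r' = norm xstar + 2 * R"
  have "r' > 0" using R by (simp add: r'_def add_nonneg_pos)
  from A2ii[OF this] obtain n1 K where K:
    "\<And>n x. n \<ge> n1 \<Longrightarrow> x \<in> S0 \<Longrightarrow> norm x \<le> r' \<Longrightarrow> opnorm3 (Dlog 3 x) \<le> K"
    "\<And>n x. n \<ge> n1 \<Longrightarrow> x \<in> S0 \<Longrightarrow> norm x \<le> r' \<Longrightarrow> opnorm3 (D\<Phi> n 3 x) \<le> K"
    by blast
  have U_norm: "norm x \<le> r'" if "x \<in> U" for x
    using that norm_triangle_sub[of x xstar] by (simp add: U_def r'_def dist_norm norm_minus_commute)
  \<comment> \<open>Two contributions of at most \<open>max K 0\<close> bound the third derivative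
    of \<open>I n\<close> by \<open>6 * k\<close>, so the Taylor factor \<open>1 / 6\<close> leaves
    exactly \<open>k * N ^ 3\<close>. The \<open>max\<close> makes \<open>k \<ge> 0\<close> whatever
    the sign of \<open>K\<close>.\<close>
  define k where "k = max K 0 / 3"
  have k: "k \<ge> 0" by (simp add: k_def)
  \<comment> \<open>\<open>r \<le> R\<close> keeps the Taylor segments inside \<open>U\<close>; the
    other bound gives \<open>k * r \<le> c / 4\<close>, so the quadratic term dominates the cubic
    one. The \<open>+ 1\<close> avoids a division by zero when \<open>k = 0\<close>.\<close>
  define r where "r = min R (c / (4 * (k + 1)))"
  have r: "r > 0" "r \<le> R" using R c k by (auto simp: r_def)
  have kr: "k * r \<le> c / 4"
  proof -
    have "k * r \<le> (k + 1) * (c / (4 * (k + 1)))"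
      using k r by (intro mult_mono) (auto simp: r_def)
    also have "\<dots> = c / 4" using k by (simp add: field_simps)
    finally show ?thesis .
  qed
  from A2ii[OF r(1)] obtain n2 \<delta> where \<delta>: "\<delta> > 0"
    "\<And>n x. n \<ge> n2 \<Longrightarrow> x \<in> S0 \<Longrightarrow> norm (x - xn n) > r \<Longrightarrow> I n x \<ge> \<delta>"
    by blast
  from A2iii obtain n0 \<epsilon> q where q: "0 < \<epsilon>" "\<epsilon> < 1" "\<And>x. x \<in> S0 \<Longrightarrow> q x \<ge> 0"
    "\<And>n x. n \<ge> n0 \<Longrightarrow> x \<in> S0 \<Longrightarrow> exp (- real n * I n x) \<le> q x"
    "set_integrable lborel S0 (\<lambda>x. q x powr (1 - \<epsilon>))"
    by blast
  \<comment> \<open>\<open>q\<close> is controlled on \<open>S0\<close> only; the indicator extends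
    its power to an integrable nonnegative function on the whole space.\<close>
  define q' where "q' x = indicator S0 x * q x powr (1 - \<epsilon>)" for x
  have q'_int: "integrable lborel q'"
    using q(5) by (simp add: set_integrable_def q'_def[abs_def])
  have q'_nn: "q' x \<ge> 0" for x by (simp add: q'_def)
  define g where "g n x = indicator S0 x * exp (- real n * I n x)" for n x
  \<comment> \<open>The summands are the constants of the near estimate (\<open>N \<le> r\<close>)
    and of the Gaussian tail (\<open>N > r\<close>).\<close>
  define A where "A = k\<^sup>2 / 4 + 1 / r ^ 6"
  have A: "A \<ge> 0" using r by (simp add: A_def)

  \<comment> \<open>Pointwise bound on the squared difference of the roots\<close>
  have bound: "\<forall>\<^sub>F n in sequentially. \<forall>x.
      (sqrt (g n x) - sqrt (exp (- (real n / 2) * ((x - xn n) \<bullet> (Hn n *v (x - xn n))))))\<^sup>2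
      \<le> A * ((real n)\<^sup>2 * norm (x - xn n) ^ 6 * exp (- real n * (c / 4) * (norm (x - xn n))\<^sup>2)) + exp (- (\<epsilon> * \<delta>) * real n) * q' x"
    using near_star inU coer eventually_ge_at_top[of n0] eventually_ge_at_top[of n1] eventually_ge_at_top[of n2]
  proof eventually_elim
    case (elim n)
    have n: "n \<ge> 1" "real n \<ge> 1" and xnU: "xn n \<in> U" and n0: "n0 \<le> n" and n1: "n1 \<le> n" and n2: "n2 \<le> n"
      using elim by auto
    show ?case
    proof
      fix x
      define v where "v = x - xn n"
      define N where "N = norm v"
      define Q where "Q = v \<bullet> (Hn n *v v)"
      define X where "X = (real n)\<^sup>2 * N ^ 6 * exp (- real n * (c / 4) * N\<^sup>2)"
      have N: "N \<ge> 0" by (simp add: N_def)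
      have X: "X \<ge> 0" by (simp add: X_def N)
      have Q: "Q \<ge> c * N\<^sup>2" using elim by (simp add: Q_def N_def)
      have tail: "exp (- (\<epsilon> * \<delta>) * real n) * q' x \<ge> 0" using q'_nn by simp
      have "(sqrt (g n x) - sqrt (exp (- (real n / 2) * Q)))\<^sup>2 \<le> A * X + exp (- (\<epsilon> * \<delta>) * real n) * q' x"
      proof (cases "N \<le> r")
        case True
        have seg: "xn n + t *\<^sub>R v \<in> U" if "0 \<le> t" "t \<le> 1" for t
        proof -
          have "dist xstar (xn n + t *\<^sub>R v) \<le> dist xstar (xn n) + dist (xn n) (xn n + t *\<^sub>R v)"
            by (rule dist_triangle)
          also have "dist (xn n) (xn n + t *\<^sub>R v) = t * N"
            using that by (simp add: dist_norm N_def)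
          also have "t * N \<le> 1 * r" using that True N by (intro mult_mono) auto
          finally show ?thesis
            using elim(1) r(2) by (simp add: U_def dist_commute)
        qed
        have x: "xn n + v = x" by (simp add: v_def)
        have "x \<in> U" using seg[of 1] by (simp add: x)
        then have xS: "x \<in> S0" using US by blast
        obtain t where t: "0 < t" "t < 1" and
          T: "I n x = I n (xn n) + DI n 1 (xn n) [v] + DI n 2 (xn n) [v, v] / 2 + DI n 3 (xn n + t *\<^sub>R v) [v, v, v] / 6"
          using has_derivs_on_Taylor3[OF oU IU[OF n(1)] seg] unfolding x by blast
        define y where "y = xn n + t *\<^sub>R v"
        have y: "y \<in> U" using seg[of t] t by (simp add: y_def)
        then have yS: "y \<in> S0" "norm y \<le> r'" using US U_norm by auto
        \<comment> \<open>Value and gradient of \<open>I n\<close> vanish at \<open>xn n\<close> and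
          the second-order term is \<open>Q / 2\<close>, so only the third-order remainder is
          left.\<close>
        have "I n x - Q / 2 = DI n 3 y [v, v, v] / 6"
          unfolding T using I_xn_zero[OF n(1)] grad_I_xn[OF n(1)] hess_mat_quadratic_form[OF oU IU[OF n(1)] xnU]
          by (simp add: Q_def Hn_def y_def)
        moreover have "\<bar>DI n 3 y [v, v, v]\<bar> \<le> 6 * k * N ^ 3"
        proof -
          have "\<bar>D\<Phi> n 3 y [v, v, v]\<bar> \<le> opnorm3 (D\<Phi> n 3 y) * N ^ 3"
            unfolding N_def by (rule third_derivative_le_opnorm3[OF oU \<Phi>U[OF n(1)] y])
          also have "\<dots> \<le> 3 * k * N ^ 3"
            using K(2)[OF n1 yS] N by (intro mult_right_mono) (auto simp: k_def le_max_iff_disj)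
          finally have 1: "\<bar>D\<Phi> n 3 y [v, v, v]\<bar> \<le> 3 * k * N ^ 3" .
          have "\<bar>Dlog 3 y [v, v, v]\<bar> \<le> opnorm3 (Dlog 3 y) * N ^ 3"
            unfolding N_def by (rule third_derivative_le_opnorm3[OF oU logU y])
          also have "\<dots> \<le> 3 * k * N ^ 3"
            using K(1)[OF n1 yS] N by (intro mult_right_mono) (auto simp: k_def le_max_iff_disj)
          finally have 2: "\<bar>Dlog 3 y [v, v, v]\<bar> \<le> 3 * k * N ^ 3" .
          have "\<bar>1 / real n * Dlog 3 y [v, v, v]\<bar> = 1 / real n * \<bar>Dlog 3 y [v, v, v]\<bar>"
            by (simp add: abs_mult)
          also have "\<dots> \<le> 1 * \<bar>Dlog 3 y [v, v, v]\<bar>"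
            using n by (intro mult_right_mono) auto
          finally have 3: "\<bar>1 / real n * Dlog 3 y [v, v, v]\<bar> \<le> 3 * k * N ^ 3"
            using 2 by linarith
          have "DI n 3 y [v, v, v] = D\<Phi> n 3 y [v, v, v] - 1 / real n * Dlog 3 y [v, v, v]"
            by (rule DI_eq[OF n(1) y]) simp_all
          then show ?thesis using 1 3 by linarith
        qed
        ultimately have "\<bar>I n x - Q / 2\<bar> \<le> k * N ^ 3" by simp
        moreover have "k * N \<le> c / 4"
          using mult_left_mono[OF True k] kr by linarith
        ultimately have "(sqrt (exp (- real n * I n x)) - sqrt (exp (- (real n / 2) * Q)))\<^sup>2 \<le> k\<^sup>2 / 4 * X"
          unfolding X_def using n N k Q by (intro sqrt_exp_diff_near_le) auto
        also have "\<dots> \<le> A * X"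
          using X r by (intro mult_right_mono) (auto simp: A_def)
        finally show ?thesis using tail xS by (simp add: g_def)
      next
        case False
        then have far: "r < N" by simp
        have "(sqrt (g n x) - sqrt (exp (- (real n / 2) * Q)))\<^sup>2 \<le> g n x + exp (- (real n / 2) * Q)"
          by (rule sqrt_diff_square_le_add) (auto simp: g_def)
        also have "exp (- (real n / 2) * Q) \<le> 1 / r ^ 6 * X"
          unfolding X_def using n r far c Q by (intro exp_far_le) auto
        also have "1 / r ^ 6 * X \<le> A * X"
          using X by (intro mult_right_mono) (auto simp: A_def)
        also have "g n x \<le> exp (- (\<epsilon> * \<delta>) * real n) * q' x"
        proof (cases "x \<in> S0")
          case True
          have "\<delta> \<le> I n x" using \<delta>(2)[OF n2 True] far by (simp add: N_def v_def)
          then have "\<epsilon> * real n * \<delta> \<le> \<epsilon> * real n * I n x" using q(1) by (intro mult_left_mono) auto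
          then have e1: "exp (- (\<epsilon> * real n * I n x)) \<le> exp (- (\<epsilon> * \<delta>) * real n)" by (simp add: mult_ac)
          have "exp (- real n * I n x) powr (1 - \<epsilon>) \<le> q x powr (1 - \<epsilon>)"
            using q(2) q(4)[OF n0 True] by (intro powr_mono2) auto
          then have e2: "exp ((1 - \<epsilon>) * (- real n * I n x)) \<le> q x powr (1 - \<epsilon>)"
            by (simp add: powr_def)
          have "- real n * I n x = - (\<epsilon> * real n * I n x) + (1 - \<epsilon>) * (- real n * I n x)"
            by (simp add: algebra_simps)
          then have "exp (- real n * I n x) = exp (- (\<epsilon> * real n * I n x)) * exp ((1 - \<epsilon>) * (- real n * I n x))"
            by (metis exp_add)
          also have "\<dots> \<le> exp (- (\<epsilon> * \<delta>) * real n) * q x powr (1 - \<epsilon>)"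
            using e1 e2 by (intro mult_mono) auto
          finally show ?thesis using True by (simp add: g_def q'_def)
        qed (simp add: g_def q'_def)
        finally show ?thesis by simp
      qed
      then show "(sqrt (g n x) - sqrt (exp (- (real n / 2) * ((x - xn n) \<bullet> (Hn n *v (x - xn n))))))\<^sup>2
      \<le> A * ((real n)\<^sup>2 * norm (x - xn n) ^ 6 * exp (- real n * (c / 4) * (norm (x - xn n))\<^sup>2)) + exp (- (\<epsilon> * \<delta>) * real n) * q' x"
        unfolding X_def Q_def N_def v_def .
    qed
  qed

  \<comment> \<open>Identification of \<open>\<mu> n\<close> with the normalised
    \<open>g n\<close>\<close>
  have [measurable]: "\<pi>0 \<in> borel_measurable borel" using \<pi>0_meas by simp
  have S0_borel[measurable]: "S0 \<in> sets borel" unfolding S0_def by measurable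
  have g_meas: "g n \<in> borel_measurable borel" if "n \<ge> 1" for n
  proof -
    have "continuous_on S0 (\<lambda>x. exp (- real n * I n x))"
      by (intro continuous_intros has_derivs_on_continuous_on[OF I_derivs[OF that]]) simp
    from borel_measurable_continuous_on_indicator[OF S0_borel this]
    show ?thesis by (simp add: g_def[abs_def])
  qed
  have \<Phi>_meas: "(\<lambda>x. indicator S0 x * exp (- real n * \<Phi> n x)) \<in> borel_measurable borel" if "n \<ge> 1" for n
  proof -
    have "continuous_on S0 (\<lambda>x. exp (- real n * \<Phi> n x))"
      by (intro continuous_intros has_derivs_on_continuous_on[OF \<Phi>_C3[OF that]]) simp
    from borel_measurable_continuous_on_indicator[OF S0_borel this]
    show ?thesis by simp
  qed
  \<comment> \<open>The logarithm in \<open>I n\<close> turns the prior density into a factor of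
    \<open>exp (- real n * I n x)\<close>. For \<open>n = 0\<close> the term
    \<open>1 / real n\<close> is \<open>0\<close> and the identity would fail in general, hence
    \<open>n \<ge> 1\<close>.\<close>
  have g_eq: "\<pi>0 x * (indicator S0 x * exp (- real n * \<Phi> n x)) = g n x" if "n \<ge> 1" for n x
  proof (cases "x \<in> S0")
    case True
    then have "\<pi>0 x > 0" by (simp add: S0_def)
    have "- real n * I n x = - real n * \<Phi> n x + ln (\<pi>0 x)"
      using that by (simp add: I_def algebra_simps)
    then have "exp (- real n * I n x) = exp (- real n * \<Phi> n x) * \<pi>0 x"
      using \<open>\<pi>0 x > 0\<close> by (simp only: exp_add exp_ln)
    then show ?thesis using True by (simp add: g_def)
  qed (simp add: g_def)
  have g_nn: "g n x \<ge> 0" for n x by (simp add: g_def)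
  have Z_g: "(\<integral>\<^sup>+x. ennreal (g n x) \<partial>lborel) = ennreal (enn2real (Z n))" if "n \<ge> 1" for n
  proof -
    have "Z n = (\<integral>\<^sup>+x. ennreal (indicator S0 x * exp (- real n * \<Phi> n x)) \<partial>\<mu>0)"
      unfolding Z_def by (intro nn_integral_cong) (simp add: indicator_def)
    also have "\<dots> = (\<integral>\<^sup>+x. ennreal (\<pi>0 x) * ennreal (indicator S0 x * exp (- real n * \<Phi> n x)) \<partial>lborel)"
      unfolding \<mu>0_def using \<Phi>_meas[OF that] by (subst nn_integral_density) auto
    also have "\<dots> = (\<integral>\<^sup>+x. ennreal (g n x) \<partial>lborel)"
      unfolding g_eq[OF that, symmetric]
      by (intro nn_integral_cong ennreal_mult[symmetric]) (auto simp: \<pi>0_nonneg)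
    finally show ?thesis using Z_pos[OF that] by (simp add: less_top)
  qed
  have Z_pos': "enn2real (Z n) > 0" if "n \<ge> 1" for n
    using Z_pos[OF that] by (simp add: enn2real_positive_iff)
  have rate: "(\<lambda>n. hellinger_dist (density lborel (\<lambda>x. ennreal (g n x / enn2real (Z n))))
      (gaussian (xn n) ((1 / real n) *\<^sub>R matrix_inv (Hn n)))) \<in> O(\<lambda>n. real n powr (-1/2))"
    by (rule hellinger_dist_gaussian_rate[OF g_meas g_nn Z_g Z_pos' Hn_pd Hn_lim dH q'_int q'_nn A _ _ bound])
       (use c \<delta> q in auto)
  have \<mu>_eq: "\<mu> n = density lborel (\<lambda>x. ennreal (g n x / enn2real (Z n)))" if "n \<ge> 1" for n
  proof -
    have "\<mu> n = density lborel (\<lambda>x. ennreal (\<pi>0 x) * ennreal (indicator S0 x * exp (- real n * \<Phi> n x) / enn2real (Z n)))"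
      unfolding \<mu>_def \<mu>0_def using \<Phi>_meas[OF that] by (subst density_density_eq) auto
    also have "(\<lambda>x. ennreal (\<pi>0 x) * ennreal (indicator S0 x * exp (- real n * \<Phi> n x) / enn2real (Z n)))
        = (\<lambda>x. ennreal (g n x / enn2real (Z n)))"
    proof
      fix x
      have "ennreal (\<pi>0 x) * ennreal (indicator S0 x * exp (- real n * \<Phi> n x) / enn2real (Z n))
          = ennreal (\<pi>0 x * (indicator S0 x * exp (- real n * \<Phi> n x)) / enn2real (Z n))"
        by (subst ennreal_mult[symmetric]) (auto simp: \<pi>0_nonneg)
      then show "ennreal (\<pi>0 x) * ennreal (indicator S0 x * exp (- real n * \<Phi> n x) / enn2real (Z n))
        = ennreal (g n x / enn2real (Z n))"
        unfolding g_eq[OF that] .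
    qed
    finally show ?thesis .
  qed
  \<comment> \<open>The two distances may differ at \<open>n = 0\<close>, which the asymptotic bound
    ignores.\<close>
  have "\<forall>\<^sub>F n in sequentially. hellinger_dist (\<mu> n) (L n) =
      hellinger_dist (density lborel (\<lambda>x. ennreal (g n x / enn2real (Z n))))
        (gaussian (xn n) ((1 / real n) *\<^sub>R matrix_inv (Hn n)))"
    using eventually_ge_at_top[of 1] by eventually_elim (simp add: \<mu>_eq L_def Hn_def)
  from landau_o.big.in_cong[OF this] rate show ?thesis by simp
qed

end
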